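(* Let $n\geqslant 4$ and $m=\lfloor\frac{n-1}{2}\rfloor$. Let $\bar B=\{h,x,y,e_2,\ldots,e_{n-1},x_1,\ldots,x_m,y_1,\ldots,y_m\}$ be an alphabet (of $2n-\frac{1+(-1)^n}{2}$ letters) and let $\bar V$ consist of the following $\frac12\bigl(5n^2+(2-2(-1)^n)n-\frac{3+5(-1)^n}{2}\bigr)$ monoid relations on $\bar B^*$: $(V_1)$ $e_i^2=e_i$, for $2\leqslant i\leqslant n-1$; $(V_2)$ $xyx=x$ and $yxy=y$; $(V_3)$ $yx^2y=xy^2x$; $(V_4)$ $e_ie_j=e_je_i$, for $2\leqslant i<j\leqslant n-1$; $(V_5)$ $xye_i=e_ixy$ and $yxe_i=e_iyx$, for $2\leqslant i\leqslant n-1$; $(V_6)$ $xe_{i+1}=e_ix$, for $2\leqslant i\leqslant n-2$; $(V_7)$ $x^2y=e_{n-1}x$ and $yx^2=xe_2$; $(V_8)$ $yxe_2\cdots e_{n-1}xy=xe_2\cdots e_{n-1}xy$; $(V_9)$ $x_iy_i=e_2\cdots e_ie_{i+2}\cdots e_{n-1}xy$, for $1\leqslant i\leqslant m$; $y_1x_1=e_2\cdots e_{n-1}$; $y_ix_i=e_2\cdots e_{n-i}e_{n-i+2}\cdots e_{n-1}xy$, for $2\leqslant i\leqslant m$; $(V_{10})$ $x_ie_j=x_i$ and $e_jy_i=y_i$, for $1\leqslant i\leqslant m$, $2\leqslant j\leqslant n-1$, $j\neq n-i+1$; $(V_{11})$ $e_jx_i=x_i$ and $y_ie_j=y_i$,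 for $1\leqslant i\leqslant m$, $2\leqslant j\leqslant n-1$, $j\neq i+1$; $(V_{12})$ $x_ixy=xyx_i=x_i$ and $xyy_i=y_ixy=y_i$, for $2\leqslant i\leqslant m$; $xyx_1=x_1$ and $y_1xy=y_1$; $(V_{13})$ $yxx_1=x_1yx=x^{n-2}e_{n-1}$; $yxx_i=x_iyx=x^{n-2i}e_{n-2i+1}\cdots e_{n-i}e_{n-i+2}\cdots e_{n-1}xy$, for $2\leqslant i\leqslant m$; $yxy_i=y_iyx=y^{n-2i+1}xe_2\cdots e_ie_{i+2}\cdots e_{2i}$, for $1\leqslant i\leqslant m$; $(V_{14})$ $x_1xy=e_2x_1=y_1e_2=xyy_1=e_2\cdots e_{n-1}xy$; $x_ie_{n-i+1}=e_{i+1}x_i=y_ie_{i+1}=e_{n-i+1}y_i=e_2\cdots e_{n-1}xy$, for $2\leqslant i\leqslant m$; $(\bar V_0)$ $h^2=1$; $(\bar V_1)$ $hx=yh$; $he_i=e_{n-i+1}h$, for $2\leqslant i\leqslant\lfloor\frac{n+1}{2}\rfloor$; $hx_i=y^{n-i-1}x_ix^{i-1}h$ and $hy_i=y^{i-1}y_ix^{n-i-1}h$, for $1\leqslant i\leqslant m$; $(\bar V_2)$ $e_2\cdots e_{n-1}xyh=x^{n-1}$. Then the monoid $\mathcal{MDI}_n$ is defined by the presentation $\langle\bar B\mid\bar V\rangle$.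
   Context: Let $\Omega_n=\{1<2<\cdots<n\}$. $\mathcal{I}_n$ is the symmetric inverse monoid of all partial permutations (injective partial maps) of $\Omega_n$ under composition; maps act on the right, so $\alpha\beta$ means first $\alpha$, then $\beta$. Let $g$ be the permutation $i\mapsto i+1$ ($1\leqslant i\leqslant n-1$), $n\mapsto 1$, and $h$ the permutation $i\mapsto n+1-i$; they generate the dihedral group $\mathcal{D}_{2n}$ of order $2n$ inside the symmetric group on $\Omega_n$. The dihedral inverse monoid $\mathcal{DI}_n$ is the submonoid of $\mathcal{I}_n$ of all restrictions (to arbitrary subsets of $\Omega_n$) of elements of $\mathcal{D}_{2n}$. An $\alpha\in\mathcal{I}_n$ is order-preserving [order-reversing] if $a\leqslant b$ implies $a\alpha\leqslant b\alpha$ [$a\alpha\geqslant b\alpha$] for all $a,b\in\mathrm{Dom}(\alpha)$, and monotone if it is order-preserving or order-reversing. $\mathcal{MDI}_n$ is the monoid of all monotone elements of $\mathcal{DI}_n$. A monoid $M$ is defined by a presentation $\langle\bar B\mid\bar V\rangle$, where $\bar V\subseteq\bar B^*\times\bar B^*$, if $M\cong\bar B^*/\rho_{\bar V}$, where $\rho_{\bar V}$ is the smallest congruence on the free monoid $\bar B^*$ containing $\bar V$. Conventions: $1$ denotes the empty word, and $u^0=1$; $e_a\cdots e_b$ denotes the product of the letters $e_k$, $a\leqslant k\leqslant b$, in increasing order of index, and is the empty word if $a>b$. A chain of $k$ equalities counts as $k$ relations. *)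

theory Defs
  imports Complex_Main "HOL-Algebra.Sym_Groups"
begin

section \<open>The monoid of monotone elements of the dihedral inverse monoid\<close>

text \<open>
  Partial maps act on the right, so the product \<open>\<alpha> \<beta>\<close> (first \<open>\<alpha>\<close>, then \<open>\<beta>\<close>) is \<open>\<beta> \<circ>\<^sub>m \<alpha>\<close>.
\<close>

definition sym_inv_monoid :: "nat \<Rightarrow> (nat \<rightharpoonup> nat) monoid" where
  "sym_inv_monoid n =
     \<lparr>carrier = {\<alpha>. dom \<alpha> \<subseteq> {1..n} \<and> ran \<alpha> \<subseteq> {1..n} \<and> inj_on \<alpha> (dom \<alpha>)},
      mult = (\<lambda>\<alpha> \<beta>. \<beta> \<circ>\<^sub>m \<alpha>),
      one = Some |` {1..n}\<rparr>"

text \<open>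
  As in \<^const>\<open>sym_group\<close>, permutations of \<open>{1..n}\<close> are total functions that fix every number
  outside \<open>{1..n}\<close>. There the product is \<open>(\<circ>)\<close>, i.e. maps act on the left, but a subset generates
  the same subgroup for either order of multiplication.
\<close>

definition rot_perm :: "nat \<Rightarrow> nat \<Rightarrow> nat" where
  "rot_perm n i = (if 1 \<le> i \<and> i \<le> n - 1 then i + 1 else if i = n then 1 else i)"

definition refl_perm :: "nat \<Rightarrow> nat \<Rightarrow> nat" where
  "refl_perm n i = (if 1 \<le> i \<and> i \<le> n then n + 1 - i else i)"

definition dihedral_perms :: "nat \<Rightarrow> (nat \<Rightarrow> nat) set" where
  "dihedral_perms n = generate (sym_group n) {rot_perm n, refl_perm n}"

definition dihedral_inv_monoid :: "nat \<Rightarrow> (nat \<rightharpoonup> nat) monoid" where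
  "dihedral_inv_monoid n = (sym_inv_monoid n)
     \<lparr>carrier := {(Some \<circ> p) |` A | p A. p \<in> dihedral_perms n \<and> A \<subseteq> {1..n}}\<rparr>"

definition order_preserving_pmap :: "(nat \<rightharpoonup> nat) \<Rightarrow> bool" where
  "order_preserving_pmap \<alpha> \<longleftrightarrow>
     (\<forall>a\<in>dom \<alpha>. \<forall>b\<in>dom \<alpha>. a \<le> b \<longrightarrow> the (\<alpha> a) \<le> the (\<alpha> b))"

definition order_reversing_pmap :: "(nat \<rightharpoonup> nat) \<Rightarrow> bool" where
  "order_reversing_pmap \<alpha> \<longleftrightarrow>
     (\<forall>a\<in>dom \<alpha>. \<forall>b\<in>dom \<alpha>. a \<le> b \<longrightarrow> the (\<alpha> a) \<ge> the (\<alpha> b))"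

definition monotone_pmap :: "(nat \<rightharpoonup> nat) \<Rightarrow> bool" where
  "monotone_pmap \<alpha> \<longleftrightarrow> order_preserving_pmap \<alpha> \<or> order_reversing_pmap \<alpha>"

definition MDI :: "nat \<Rightarrow> (nat \<rightharpoonup> nat) monoid" where
  "MDI n = (dihedral_inv_monoid n)
     \<lparr>carrier := {\<alpha> \<in> carrier (dihedral_inv_monoid n). monotone_pmap \<alpha>}\<rparr>"


section \<open>Monoid presentations\<close>

definition free_monoid :: "'a set \<Rightarrow> 'a list monoid" where
  "free_monoid B = \<lparr>carrier = lists B, mult = (@), one = []\<rparr>"

definition monoid_congruence :: "('a, 'b) monoid_scheme \<Rightarrow> ('a \<times> 'a) set \<Rightarrow> bool" where
  "monoid_congruence M r \<longleftrightarrow> equiv (carrier M) r \<and>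
     (\<forall>(a, b)\<in>r. \<forall>(c, d)\<in>r. (a \<otimes>\<^bsub>M\<^esub> c, b \<otimes>\<^bsub>M\<^esub> d) \<in> r)"

definition generated_congruence ::
    "('a, 'b) monoid_scheme \<Rightarrow> ('a \<times> 'a) set \<Rightarrow> ('a \<times> 'a) set" where
  "generated_congruence M V = \<Inter>{r. monoid_congruence M r \<and> V \<subseteq> r}"

definition quotient_monoid ::
    "('a, 'b) monoid_scheme \<Rightarrow> ('a \<times> 'a) set \<Rightarrow> 'a set monoid" where
  "quotient_monoid M r =
     \<lparr>carrier = carrier M // r,
      mult = (\<lambda>P Q. \<Union>p\<in>P. \<Union>q\<in>Q. r `` {p \<otimes>\<^bsub>M\<^esub> q}),
      one = r `` {\<one>\<^bsub>M\<^esub>}\<rparr>"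

text \<open>
  \<^const>\<open>is_iso\<close> only asks for a bijection compatible with multiplication; between monoids such a
  bijection also preserves the identity. The condition \<open>V \<subseteq> lists B \<times> lists B\<close> is part of the
  notion of a presentation over \<open>B\<close>.
\<close>

definition defined_by_presentation ::
    "('m, 'c) monoid_scheme \<Rightarrow> 'a set \<Rightarrow> ('a list \<times> 'a list) set \<Rightarrow> bool" where
  "defined_by_presentation M B V \<longleftrightarrow> V \<subseteq> lists B \<times> lists B \<and>
     M \<cong> quotient_monoid (free_monoid B) (generated_congruence (free_monoid B) V)"


section \<open>The alphabet and the relations\<close>

text \<open>The letters \<open>h\<close>, \<open>x\<close>, \<open>y\<close>, \<open>e\<^sub>i\<close>, \<open>x\<^sub>i\<close>, \<open>y\<^sub>i\<close>, in this order.\<close>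

datatype letter = H | X | Y | E nat | Xi nat | Yi nat

definition alphabet :: "nat \<Rightarrow> nat \<Rightarrow> letter set" where
  "alphabet n m = {H, X, Y} \<union> E ` {2..n - 1} \<union> Xi ` {1..m} \<union> Yi ` {1..m}"

abbreviation pow :: "letter \<Rightarrow> nat \<Rightarrow> letter list" where
  "pow a k \<equiv> replicate k a"

text \<open>The word \<open>e\<^sub>a \<cdots> e\<^sub>b\<close>, which is empty if \<open>a > b\<close>.\<close>

definition es :: "nat \<Rightarrow> nat \<Rightarrow> letter list" where
  "es a b = map E [a..<Suc b]"

text \<open>
  A chain of equalities \<open>w\<^sub>0 = w\<^sub>1 = \<dots> = w\<^sub>k\<close> stands for the \<open>k\<close> relations
  \<open>(w\<^sub>0, w\<^sub>1), \<dots>, (w\<^sub>k\<^sub>-\<^sub>1, w\<^sub>k)\<close>.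
\<close>

definition chain :: "'a list list \<Rightarrow> ('a list \<times> 'a list) set" where
  "chain ws = set (zip ws (tl ws))"

definition V1 :: "nat \<Rightarrow> (letter list \<times> letter list) set" where
  "V1 n = (\<Union>i\<in>{2..n - 1}. chain [[E i, E i], [E i]])"

definition V2 :: "(letter list \<times> letter list) set" where
  "V2 = chain [[X, Y, X], [X]] \<union> chain [[Y, X, Y], [Y]]"

definition V3 :: "(letter list \<times> letter list) set" where
  "V3 = chain [[Y, X, X, Y], [X, Y, Y, X]]"

definition V4 :: "nat \<Rightarrow> (letter list \<times> letter list) set" where
  "V4 n = (\<Union>i\<in>{2..n - 1}. \<Union>j\<in>{i<..n - 1}. chain [[E i, E j], [E j, E i]])"

definition V5 :: "nat \<Rightarrow> (letter list \<times> letter list) set" where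
  "V5 n = (\<Union>i\<in>{2..n - 1}.
     chain [[X, Y, E i], [E i, X, Y]] \<union> chain [[Y, X, E i], [E i, Y, X]])"

definition V6 :: "nat \<Rightarrow> (letter list \<times> letter list) set" where
  "V6 n = (\<Union>i\<in>{2..n - 2}. chain [[X, E (i + 1)], [E i, X]])"

definition V7 :: "nat \<Rightarrow> (letter list \<times> letter list) set" where
  "V7 n = chain [[X, X, Y], [E (n - 1), X]] \<union> chain [[Y, X, X], [X, E 2]]"

definition V8 :: "nat \<Rightarrow> (letter list \<times> letter list) set" where
  "V8 n = chain [[Y, X] @ es 2 (n - 1) @ [X, Y], [X] @ es 2 (n - 1) @ [X, Y]]"

definition V9 :: "nat \<Rightarrow> nat \<Rightarrow> (letter list \<times> letter list) set" where
  "V9 n m =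
     (\<Union>i\<in>{1..m}. chain [[Xi i, Yi i], es 2 i @ es (i + 2) (n - 1) @ [X, Y]]) \<union>
     chain [[Yi 1, Xi 1], es 2 (n - 1)] \<union>
     (\<Union>i\<in>{2..m}. chain [[Yi i, Xi i], es 2 (n - i) @ es (n - i + 2) (n - 1) @ [X, Y]])"

definition V10 :: "nat \<Rightarrow> nat \<Rightarrow> (letter list \<times> letter list) set" where
  "V10 n m = (\<Union>i\<in>{1..m}. \<Union>j\<in>{2..n - 1} - {n - i + 1}.
     chain [[Xi i, E j], [Xi i]] \<union> chain [[E j, Yi i], [Yi i]])"

definition V11 :: "nat \<Rightarrow> nat \<Rightarrow> (letter list \<times> letter list) set" where
  "V11 n m = (\<Union>i\<in>{1..m}. \<Union>j\<in>{2..n - 1} - {i + 1}.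
     chain [[E j, Xi i], [Xi i]] \<union> chain [[Yi i, E j], [Yi i]])"

definition V12 :: "nat \<Rightarrow> (letter list \<times> letter list) set" where
  "V12 m =
     (\<Union>i\<in>{2..m}.
        chain [[Xi i, X, Y], [X, Y, Xi i], [Xi i]] \<union>
        chain [[X, Y, Yi i], [Yi i, X, Y], [Yi i]]) \<union>
     chain [[X, Y, Xi 1], [Xi 1]] \<union> chain [[Yi 1, X, Y], [Yi 1]]"

definition V13 :: "nat \<Rightarrow> nat \<Rightarrow> (letter list \<times> letter list) set" where
  "V13 n m =
     chain [[Y, X, Xi 1], [Xi 1, Y, X], pow X (n - 2) @ [E (n - 1)]] \<union>
     (\<Union>i\<in>{2..m}. chain
        [[Y, X, Xi i], [Xi i, Y, X],
         pow X (n - 2 * i) @ es (n - 2 * i + 1) (n - i) @ es (n - i + 2) (n - 1) @ [X, Y]]) \<union>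
     (\<Union>i\<in>{1..m}. chain
        [[Y, X, Yi i], [Yi i, Y, X],
         pow Y (n - 2 * i + 1) @ [X] @ es 2 i @ es (i + 2) (2 * i)])"

definition V14 :: "nat \<Rightarrow> nat \<Rightarrow> (letter list \<times> letter list) set" where
  "V14 n m =
     chain [[Xi 1, X, Y], [E 2, Xi 1], [Yi 1, E 2], [X, Y, Yi 1], es 2 (n - 1) @ [X, Y]] \<union>
     (\<Union>i\<in>{2..m}. chain
        [[Xi i, E (n - i + 1)], [E (i + 1), Xi i], [Yi i, E (i + 1)], [E (n - i + 1), Yi i],
         es 2 (n - 1) @ [X, Y]])"

definition Vbar0 :: "(letter list \<times> letter list) set" where
  "Vbar0 = chain [[H, H], []]"

definition Vbar1 :: "nat \<Rightarrow> nat \<Rightarrow> (letter list \<times> letter list) set" where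
  "Vbar1 n m =
     chain [[H, X], [Y, H]] \<union>
     (\<Union>i\<in>{2..(n + 1) div 2}. chain [[H, E i], [E (n - i + 1), H]]) \<union>
     (\<Union>i\<in>{1..m}.
        chain [[H, Xi i], pow Y (n - i - 1) @ [Xi i] @ pow X (i - 1) @ [H]] \<union>
        chain [[H, Yi i], pow Y (i - 1) @ [Yi i] @ pow X (n - i - 1) @ [H]])"

definition Vbar2 :: "nat \<Rightarrow> (letter list \<times> letter list) set" where
  "Vbar2 n = chain [es 2 (n - 1) @ [X, Y, H], pow X (n - 1)]"

definition relations :: "nat \<Rightarrow> nat \<Rightarrow> (letter list \<times> letter list) set" where
  "relations n m =
     V1 n \<union> V2 \<union> V3 \<union> V4 n \<union> V5 n \<union> V6 n \<union> V7 n \<union> V8 n \<union> V9 n m \<union> V10 n m \<union> V11 n m \<union>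
     V12 m \<union> V13 n m \<union> V14 n m \<union> Vbar0 \<union> Vbar1 n m \<union> Vbar2 n"

end

theory Submission
  imports Defs
begin

text \<open>
  Put \<open>f\<^sub>1 = y x\<close>, \<open>f\<^sub>n = x y\<close> and \<open>f\<^sub>i = e\<^sub>i\<close> otherwise. The relations make the \<open>f\<^sub>i\<close> commuting
  idempotents with \<open>x f\<^sub>i\<^sub>+\<^sub>1 = f\<^sub>i x\<close>, so every word in \<open>x, y, e\<^sub>i\<close> is equal to a product of \<open>f\<^sub>i\<close>
  followed by a power of \<open>x\<close> or \<open>y\<close>, a partial translation. A letter \<open>z\<close> among the \<open>x\<^sub>i, y\<^sub>i\<close> acts as
  \<open>1 \<mapsto> 1, p \<mapsto> q\<close>; it absorbs \<open>f\<^sub>j\<close> for all other points \<open>j\<close>, and multiplying it by \<open>f\<^sub>1\<close>, \<open>f\<^sub>p\<close> or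
  \<open>f\<^sub>q\<close> on the relevant side, or by another such letter, gives a translation. Hence a word
  without \<open>h\<close> is a translation or has the form \<open>y\<^sup>a z x\<^sup>c\<close>, and its partial map determines this
  normal form. Every word is \<open>u\<close> or \<open>u h\<close> with \<open>u\<close> free of \<open>h\<close>; words of the two kinds act alike
  only in rank at most 1, where \<open>e\<^sub>2 \<cdots> e\<^sub>n\<^sub>-\<^sub>1 x y h = x\<^sup>n\<^sup>-\<^sup>1\<close> removes \<open>h\<close>. Conversely, dihedral permutations
  preserve cyclic distance, so an order-preserving restriction of one is either a translation or
  a map of rank 2 that turns a distance \<open>d\<close> into \<open>n - d\<close>.
\<close>

section \<open>Words as partial maps\<close>

text \<open>Soundness puts the generated congruence inside the kernel of the action; the substance
  is the converse, that words acting alike are congruent. Carrying explicit normal forms through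
  every product would be heavy, because multiplying one of the letters x_i, y_i by
  \<open>f 1\<close> or by its inverse produces the long words of (V9) and (V13). Existence and
  uniqueness are therefore separated: right multiplication by letters only shows that some normal
  form is reached, and soundness then reads its parameters off the partial map. The collapses to
  translations share one device: if a factor is undefined at a point, or its image omits the point,
  the idempotent deleting that point can be inserted at no cost, and beside one of the letters x_i,
  y_i it may be chosen so that the letter loses rank. The empty map is a separate obstacle, since it
  does not determine the shift of a translation; (V8) makes all shifts of it equal. Algebraic
  rewriting wants a type, while the quotient is a set of classes. The left regular representation of
  the quotient bridges the two.\<close>

fun step :: "nat \<Rightarrow> letter \<Rightarrow> nat \<rightharpoonup> nat" where
  "step n H i = (if 1 \<le> i \<and> i \<le> n then Some (n + 1 - i) else None)"
| "step n X i = (if 1 \<le> i \<and> i < n then Some (i + 1) else None)"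
| "step n Y i = (if 1 < i \<and> i \<le> n then Some (i - 1) else None)"
| "step n (E j) i = (if 1 \<le> i \<and> i \<le> n \<and> i \<noteq> j then Some i else None)"
| "step n (Xi k) i = (if i = 1 then Some 1 else if i = k + 1 then Some (n + 1 - k) else None)"
| "step n (Yi k) i = (if i = 1 then Some 1 else if i = n + 1 - k then Some (k + 1) else None)"

fun act :: "nat \<Rightarrow> letter list \<Rightarrow> nat \<rightharpoonup> nat" where
  "act n [] = Some |` {1..n}"
| "act n (l # w) = act n w \<circ>\<^sub>m step n l"

lemma act_Nil_apply: "act n [] i = (if 1 \<le> i \<and> i \<le> n then Some i else None)"
  by (simp add: restrict_map_def)

lemma act_Cons_apply: "act n (l # w) i = (case step n l i of None \<Rightarrow> None | Some j \<Rightarrow> act n w j)"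
  by (simp add: map_comp_def)

declare act.simps [simp del]
lemmas act_apply = act_Nil_apply act_Cons_apply

lemma step_bounds:
  "\<lbrakk>l \<in> alphabet n m; m < n; step n l i = Some j\<rbrakk> \<Longrightarrow> i \<in> {1..n} \<and> j \<in> {1..n}"
  by (auto simp: alphabet_def split: if_splits)

lemma act_bounds:
  "\<lbrakk>w \<in> lists (alphabet n m); m < n; act n w i = Some j\<rbrakk> \<Longrightarrow> i \<in> {1..n} \<and> j \<in> {1..n}"
proof (induction w arbitrary: i)
  case Nil
  then show ?case by (auto simp: act_apply split: if_splits)
next
  case (Cons l w)
  then show ?case
    using step_bounds[of l n m i] by (auto simp: act_Cons_apply split: option.splits)
qed

lemma act_outside: "w \<in> lists (alphabet n m) \<Longrightarrow> m < n \<Longrightarrow> i \<notin> {1..n} \<Longrightarrow> act n w i = None"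
  using act_bounds by (metis option.exhaust)

text \<open>The case \<open>u = []\<close> is the reason for taking \<open>v\<close> over the
  alphabet: the identity on \<open>{1..n}\<close> is neutral only before a map whose domain lies in
  \<open>{1..n}\<close>.\<close>

lemma act_append:
  assumes "u \<in> lists (alphabet n m)" "v \<in> lists (alphabet n m)" "m < n"
  shows "act n (u @ v) = act n v \<circ>\<^sub>m act n u"
  using assms(1)
proof (induction u)
  case Nil
  show ?case
    using act_outside[OF assms(2,3)] by (auto simp: fun_eq_iff map_comp_def act_Nil_apply)
next
  case (Cons l u)
  then show ?case
    by (auto simp: fun_eq_iff act_Cons_apply map_comp_def split: option.splits)
qed

lemma act_append_apply:
  assumes "u \<in> lists (alphabet n m)" "v \<in> lists (alphabet n m)" "m < n"
  shows "act n (u @ v) i = (case act n u i of None \<Rightarrow> None | Some j \<Rightarrow> act n v j)"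
  using act_append[OF assms] by (simp add: map_comp_def)

text \<open>The last branch repeats the left-hand side and so claims nothing outside
  \<open>{1..n}\<close>, where the value depends on whether \<open>js\<close> is empty.\<close>

lemma act_E_list:
  "act n (map E js @ w) i = (if i \<in> set js then None else if 1 \<le> i \<and> i \<le> n then act n w i
     else act n (map E js @ w) i)"
  by (induction js) (auto simp: act_apply)

lemma act_es: "1 \<le> i \<Longrightarrow> i \<le> n \<Longrightarrow>
    act n (es a b @ w) i = (if a \<le> i \<and> i \<le> b then None else act n w i)"
  unfolding es_def by (subst act_E_list) auto

lemma act_X: "1 \<le> i \<Longrightarrow> i \<le> n \<Longrightarrow>
    act n (pow X k @ w) i = (if i + k \<le> n then act n w (i + k) else None)"
  by (induction k arbitrary: i) (auto simp: act_apply)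

lemma act_Y: "1 \<le> i \<Longrightarrow> i \<le> n \<Longrightarrow>
    act n (pow Y k @ w) i = (if k < i then act n w (i - k) else None)"
  by (induction k arbitrary: i) (auto simp: act_apply)

lemma act_letter:
  "act n (H # w) i = (if 1 \<le> i \<and> i \<le> n then act n w (n + 1 - i) else None)"
  "act n (X # w) i = (if 1 \<le> i \<and> i < n then act n w (i + 1) else None)"
  "act n (Y # w) i = (if 1 < i \<and> i \<le> n then act n w (i - 1) else None)"
  "act n (E j # w) i = (if 1 \<le> i \<and> i \<le> n \<and> i \<noteq> j then act n w i else None)"
  "act n (Xi k # w) i =
    (if i = 1 then act n w 1 else if i = k + 1 then act n w (n + 1 - k) else None)"
  "act n (Yi k # w) i =
    (if i = 1 then act n w 1 else if i = n + 1 - k then act n w (k + 1) else None)"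
  by (simp_all add: act_Cons_apply)

text \<open>The instances with \<open>[]\<close> serve blocks at the end of a word, which do not
  match the pattern with a remaining word \<open>w\<close>.\<close>

lemmas act_words = act_Nil_apply act_letter act_es act_es[of _ _ _ _ "[]", simplified]
  act_X act_X[of _ _ _ "[]", simplified] act_Y act_Y[of _ _ _ "[]", simplified]

lemma act_eqI:
  assumes "u \<in> lists (alphabet n m)" "v \<in> lists (alphabet n m)" "m < n"
    and "\<And>i. 1 \<le> i \<Longrightarrow> i \<le> n \<Longrightarrow> act n u i = act n v i"
  shows "act n u = act n v"
proof
  fix i
  show "act n u i = act n v i"
    using assms act_outside[OF assms(1,3), of i] act_outside[OF assms(2,3), of i]
    by (cases "i \<in> {1..n}") auto
qed


section \<open>Soundness of the relations\<close>

lemma set_es: "set (es a b) = E ` {a..b}"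
  by (auto simp: es_def)

lemma relations_in_lists:
  assumes "n \<ge> 4" "m = (n - 1) div 2"
  shows "relations n m \<subseteq> lists (alphabet n m) \<times> lists (alphabet n m)"
proof -
  have m: "m < n" "2 * m < n" "1 \<le> m" using assms by auto
  have mid: "i \<le> (n + 1) div 2 \<Longrightarrow> i < n" for i using assms(1) by auto
  have letters: "X \<in> alphabet n m" "Y \<in> alphabet n m" "H \<in> alphabet n m"
      "E i \<in> alphabet n m \<longleftrightarrow> i \<in> {2..n - 1}" "Xi i \<in> alphabet n m \<longleftrightarrow> i \<in> {1..m}"
      "Yi i \<in> alphabet n m \<longleftrightarrow> i \<in> {1..m}" for i
    by (auto simp: alphabet_def)
  note [simp] = letters chain_def
  have "V1 n \<subseteq> lists (alphabet n m) \<times> lists (alphabet n m)"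
    using assms(1) m mid unfolding V1_def by (force simp: set_es)
  moreover
  have "V2 \<subseteq> lists (alphabet n m) \<times> lists (alphabet n m)"
    using assms(1) m mid unfolding V2_def by (force simp: set_es)
  moreover
  have "V3 \<subseteq> lists (alphabet n m) \<times> lists (alphabet n m)"
    using assms(1) m mid unfolding V3_def by (force simp: set_es)
  moreover
  have "V4 n \<subseteq> lists (alphabet n m) \<times> lists (alphabet n m)"
    using assms(1) m mid unfolding V4_def by (force simp: set_es)
  moreover
  have "V5 n \<subseteq> lists (alphabet n m) \<times> lists (alphabet n m)"
    using assms(1) m mid unfolding V5_def by (force simp: set_es)
  moreover
  have "V6 n \<subseteq> lists (alphabet n m) \<times> lists (alphabet n m)"
    using assms(1) m mid unfolding V6_def by (force simp: set_es)
  moreover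
  have "V7 n \<subseteq> lists (alphabet n m) \<times> lists (alphabet n m)"
    using assms(1) m mid unfolding V7_def by (force simp: set_es)
  moreover
  have "V8 n \<subseteq> lists (alphabet n m) \<times> lists (alphabet n m)"
    using assms(1) m mid unfolding V8_def by (force simp: set_es)
  moreover
  have "V9 n m \<subseteq> lists (alphabet n m) \<times> lists (alphabet n m)"
    using assms(1) m mid unfolding V9_def by (force simp: set_es)
  moreover
  have "V10 n m \<subseteq> lists (alphabet n m) \<times> lists (alphabet n m)"
    using assms(1) m mid unfolding V10_def by (force simp: set_es)
  moreover
  have "V11 n m \<subseteq> lists (alphabet n m) \<times> lists (alphabet n m)"
    using assms(1) m mid unfolding V11_def by (force simp: set_es)
  moreover
  have "V12 m \<subseteq> lists (alphabet n m) \<times> lists (alphabet n m)"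
    using assms(1) m mid unfolding V12_def by (force simp: set_es)
  moreover
  have "V13 n m \<subseteq> lists (alphabet n m) \<times> lists (alphabet n m)"
    using m assms(1) unfolding V13_def by (force simp: set_es)
  moreover
  have "V14 n m \<subseteq> lists (alphabet n m) \<times> lists (alphabet n m)"
    using assms(1) m mid unfolding V14_def by (force simp: set_es)
  moreover
  have "Vbar0 \<subseteq> lists (alphabet n m) \<times> lists (alphabet n m)"
    using assms(1) m mid unfolding Vbar0_def by (force simp: set_es)
  moreover
  have "Vbar1 n m \<subseteq> lists (alphabet n m) \<times> lists (alphabet n m)"
    using assms(1) m mid unfolding Vbar1_def by (force simp: set_es)
  moreover
  have "Vbar2 n \<subseteq> lists (alphabet n m) \<times> lists (alphabet n m)"
    using assms(1) m mid unfolding Vbar2_def by (force simp: set_es)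
  ultimately show ?thesis
    unfolding relations_def by blast
qed

text \<open>Here \<open>f\<close> will be evaluation of the action at one point; if it is constant
  on a chain, it respects every relation that the chain stands for.\<close>

lemma chain2: "(u, v) \<in> chain [a, b] \<Longrightarrow> f a = f b \<Longrightarrow> f u = f v"
  by (auto simp: chain_def)

lemma chain5: "(u, v) \<in> chain [a, b, c, d, e] \<Longrightarrow> f a = f e \<Longrightarrow> f b = f e \<Longrightarrow> f c = f e \<Longrightarrow>
    f d = f e \<Longrightarrow> f u = f v"
  by (auto simp: chain_def)

lemma chain3: "(u, v) \<in> chain [a, b, c] \<Longrightarrow> f a = f c \<Longrightarrow> f b = f c \<Longrightarrow> f u = f v"
  by (auto simp: chain_def)

declare act_words [simp] chain_def [simp]

section \<open>Verification of each family of relations at a single point\<close>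

context
  fixes n m i :: nat and u v :: "letter list"
  assumes n: "n \<ge> 4" and m: "m < n" "2 * m < n" "1 \<le> m"
    and i: "1 \<le> i" "i \<le> n"
begin

lemma act_V1_V4: "(u, v) \<in> V1 n \<union> V2 \<union> V3 \<union> V4 n \<Longrightarrow> act n u i = act n v i"
  using n m i by (auto split: if_splits simp: V1_def V2_def V3_def V4_def)

lemma act_V5_V7: "(u, v) \<in> V5 n \<union> V6 n \<union> V7 n \<Longrightarrow> act n u i = act n v i"
  using n m i by (auto split: if_splits simp: V5_def V6_def V7_def)

lemma act_V8: "(u, v) \<in> V8 n \<Longrightarrow> act n u i = act n v i"
  using n m i by (auto split: if_splits simp: V8_def)

lemma act_V9: "(u, v) \<in> V9 n m \<Longrightarrow> act n u i = act n v i"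
  using n m i by (auto split: if_splits simp: V9_def)

lemma act_V10: "(u, v) \<in> V10 n m \<Longrightarrow> act n u i = act n v i"
  using n m i by (auto split: if_splits simp: V10_def)

lemma act_V11: "(u, v) \<in> V11 n m \<Longrightarrow> act n u i = act n v i"
  using n m i by (auto split: if_splits simp: V11_def)

lemma act_V12: "(u, v) \<in> V12 m \<Longrightarrow> act n u i = act n v i"
  using n m i by (auto split: if_splits simp: V12_def)

lemma act_V13_X1: "act n [Y, X, Xi 1] i = act n (pow X (n - 2) @ [E (n - 1)]) i"
  "act n [Xi 1, Y, X] i = act n (pow X (n - 2) @ [E (n - 1)]) i"
proof -
  obtain d where [simp]: "n = d + 4" using n le_Suc_ex by (metis add.commute)
  \<comment> \<open>\<open>x^(n - 2)\<close> is defined only at 1 and 2, and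
    \<open>E (n - 1)\<close> deletes the image of 1; only \<open>2 \<mapsto> n\<close>
    survives.\<close>
  consider "i = 1" | "i = 2" | j where "i = j + 3"
    using i(1) by (metis One_nat_def Suc_1 add.commute le_Suc_ex not_less_eq_eq numeral_3_eq_3 le_antisym)
  then show "act n [Y, X, Xi 1] i = act n (pow X (n - 2) @ [E (n - 1)]) i"
  "act n [Xi 1, Y, X] i = act n (pow X (n - 2) @ [E (n - 1)]) i"
    using i by (cases; simp)+
qed

text \<open>The power \<open>x^(n - 2 * k)\<close> carries \<open>{1..2 * k}\<close> onto
  \<open>{n - 2 * k + 1..n}\<close>. The idempotents after it delete every point of this interval
  except \<open>n + 1 - k\<close>, the image of \<open>k + 1\<close>; the final \<open>x y\<close>
  takes care of \<open>n\<close>.\<close>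

lemma act_V13_Xi: assumes "2 \<le> k" "k \<le> m"
  shows "act n [Y, X, Xi k] i = (if i = k + 1 then Some (n + 1 - k) else None)"
  "act n [Xi k, Y, X] i = (if i = k + 1 then Some (n + 1 - k) else None)"
  "act n (pow X (n - 2 * k) @ es (n - 2 * k + 1) (n - k) @ es (n - k + 2) (n - 1) @ [X, Y]) i
    = (if i = k + 1 then Some (n + 1 - k) else None)"
proof -
  have "2 * k < n" using assms m by simp
  then obtain d where [simp]: "n = 2 * k + Suc d" by (metis less_iff_Suc_add add_Suc_right)
  show "act n [Y, X, Xi k] i = (if i = k + 1 then Some (n + 1 - k) else None)"
    using i assms by simp
  show "act n [Xi k, Y, X] i = (if i = k + 1 then Some (n + 1 - k) else None)"
    using i assms by simp
  show "act n (pow X (n - 2 * k) @ es (n - 2 * k + 1) (n - k) @ es (n - k + 2) (n - 1) @ [X, Y]) i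
    = (if i = k + 1 then Some (n + 1 - k) else None)"
    using i assms by (cases "i = k + 1"; cases "i \<le> 2 * k"; simp)
qed

text \<open>The factor \<open>y^(n - 2 * k + 1) x\<close> is the shift down by
  \<open>n - 2 * k\<close> with 1 removed from its image \<open>{1..2 * k}\<close>; the idempotents
  then leave only \<open>k + 1\<close>. In the proof \<open>d + 2\<close> is the exponent of
  \<open>y\<close>, so points up to \<open>d + 2\<close> lie outside the domain.\<close>

lemma act_V13_Yi: assumes "1 \<le> k" "k \<le> m"
  shows "act n [Y, X, Yi k] i = (if i = n + 1 - k then Some (k + 1) else None)"
  "act n [Yi k, Y, X] i = (if i = n + 1 - k then Some (k + 1) else None)"
  "act n (pow Y (n - 2 * k + 1) @ [X] @ es 2 k @ es (k + 2) (2 * k)) i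
    = (if i = n + 1 - k then Some (k + 1) else None)"
proof -
  have "2 * k < n" using assms m by simp
  then obtain d where [simp]: "n = 2 * k + Suc d" by (metis less_iff_Suc_add add_Suc_right)
  show "act n [Y, X, Yi k] i = (if i = n + 1 - k then Some (k + 1) else None)"
    using i assms by simp
  show "act n [Yi k, Y, X] i = (if i = n + 1 - k then Some (k + 1) else None)"
    using i assms by simp
  show "act n (pow Y (n - 2 * k + 1) @ [X] @ es 2 k @ es (k + 2) (2 * k)) i
    = (if i = n + 1 - k then Some (k + 1) else None)"
  proof (cases "d + 2 < i")
    case True
    then obtain j where "i = d + 2 + Suc j" by (metis less_iff_Suc_add add_Suc_right)
    then show ?thesis using i assms by (cases "Suc j = k"; simp)
  qed (use i assms in \<open>simp add: replicate.simps[symmetric] del: replicate.simps\<close>)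
qed

lemma act_V13: assumes "(u, v) \<in> V13 n m" shows "act n u i = act n v i"
proof -
  consider "(u, v) \<in> chain [[Y, X, Xi 1], [Xi 1, Y, X], pow X (n - 2) @ [E (n - 1)]]"
  | k where "k \<in> {2..m}" "(u, v) \<in> chain [[Y, X, Xi k], [Xi k, Y, X],
         pow X (n - 2 * k) @ es (n - 2 * k + 1) (n - k) @ es (n - k + 2) (n - 1) @ [X, Y]]"
  | k where "k \<in> {1..m}" "(u, v) \<in> chain [[Y, X, Yi k], [Yi k, Y, X],
         pow Y (n - 2 * k + 1) @ [X] @ es 2 k @ es (k + 2) (2 * k)]"
    using assms unfolding V13_def by blast
  then show ?thesis
  proof cases
    case 1
    show ?thesis by (rule chain3[where f = "\<lambda>w. act n w i", OF 1 act_V13_X1])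
  next
    case 2
    then have k: "2 \<le> k" "k \<le> m" by auto
    show ?thesis using act_V13_Xi[OF k] by (intro chain3[where f = "\<lambda>w. act n w i", OF 2(2)]) (simp_all only:)
  next
    case 3
    then have k: "1 \<le> k" "k \<le> m" by auto
    show ?thesis using act_V13_Yi[OF k] by (intro chain3[where f = "\<lambda>w. act n w i", OF 3(2)]) (simp_all only:)
  qed
qed

lemma act_V14_1:
  "act n [Xi 1, X, Y] i = (if i = 1 then Some 1 else None)"
  "act n [E 2, Xi 1] i = (if i = 1 then Some 1 else None)"
  "act n [Yi 1, E 2] i = (if i = 1 then Some 1 else None)"
  "act n [X, Y, Yi 1] i = (if i = 1 then Some 1 else None)"
  using n i by simp_all

lemma act_e1_word: "act n (es 2 (n - 1) @ [X, Y]) i = (if i = 1 then Some 1 else None)"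
  using n i by auto

lemma act_V14_ge_2: assumes "2 \<le> k" "k \<le> m"
  shows "act n [Xi k, E (n - k + 1)] i = (if i = 1 then Some 1 else None)"
  "act n [E (k + 1), Xi k] i = (if i = 1 then Some 1 else None)"
  "act n [Yi k, E (k + 1)] i = (if i = 1 then Some 1 else None)"
  "act n [E (n - k + 1), Yi k] i = (if i = 1 then Some 1 else None)"
  using n m i assms by auto

lemma act_V14: assumes "(u, v) \<in> V14 n m" shows "act n u i = act n v i"
proof -
  consider "(u, v) \<in> chain [[Xi 1, X, Y], [E 2, Xi 1], [Yi 1, E 2], [X, Y, Yi 1], es 2 (n - 1) @ [X, Y]]"
  | k where "k \<in> {2..m}" "(u, v) \<in> chain [[Xi k, E (n - k + 1)], [E (k + 1), Xi k],
       [Yi k, E (k + 1)], [E (n - k + 1), Yi k], es 2 (n - 1) @ [X, Y]]"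
    using assms unfolding V14_def by blast
  then show ?thesis
  proof cases
    case 1
    show ?thesis by (rule chain5[where f = "\<lambda>w. act n w i", OF 1]) (simp_all only: act_V14_1 act_e1_word)
  next
    case 2
    then have k: "2 \<le> k" "k \<le> m" by auto
    show ?thesis by (rule chain5[where f = "\<lambda>w. act n w i", OF 2(2)]) (simp_all only: act_e1_word act_V14_ge_2[OF k])
  qed
qed

lemma act_Vbar0_Vbar2: "(u, v) \<in> Vbar0 \<union> Vbar2 n \<Longrightarrow> act n u i = act n v i"
  using n m i by (auto split: if_splits simp: Vbar0_def Vbar2_def)

text \<open>Applying \<open>h\<close> first reverses the pair that the letter meets, so the other
  word must present the pair in its original order: for \<open>Xi k\<close>, the power of
  \<open>y\<close> carries \<open>n - k\<close> to 1 and \<open>n\<close> to \<open>k + 1\<close>,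
  the letter acts, the power of \<open>x\<close> moves the images to \<open>k\<close> and
  \<open>n\<close>, and \<open>h\<close> reverses these. For \<open>Yi k\<close> the pair is
  \<open>k\<close>, \<open>n\<close>.\<close>

lemma act_Vbar1_Xi_Yi: assumes "1 \<le> k" "k \<le> m"
  shows "act n [H, Xi k] i = (if i = n then Some 1 else if i = n - k then Some (n + 1 - k) else None)"
  "act n (pow Y (n - k - 1) @ [Xi k] @ pow X (k - 1) @ [H]) i
   = (if i = n then Some 1 else if i = n - k then Some (n + 1 - k) else None)"
  "act n [H, Yi k] i = (if i = n then Some 1 else if i = k then Some (k + 1) else None)"
  "act n (pow Y (k - 1) @ [Yi k] @ pow X (n - k - 1) @ [H]) i
   = (if i = n then Some 1 else if i = k then Some (k + 1) else None)"
proof -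
  have "2 * k < n" using assms m by simp
  then obtain d where [simp]: "n = 2 * k + Suc d" by (metis less_iff_Suc_add add_Suc_right)
  obtain c where [simp]: "k = Suc c" using assms(1) by (metis One_nat_def Suc_le_D)
  show "act n [H, Xi k] i = (if i = n then Some 1 else if i = n - k then Some (n + 1 - k) else None)"
    "act n [H, Yi k] i = (if i = n then Some 1 else if i = k then Some (k + 1) else None)"
    using i assms by (simp; arith)+
  show "act n (pow Y (n - k - 1) @ [Xi k] @ pow X (k - 1) @ [H]) i
   = (if i = n then Some 1 else if i = n - k then Some (n + 1 - k) else None)"
  proof (cases "n - k - 1 < i")
    case True
    then obtain j where "i = n - k - 1 + Suc j" by (metis less_iff_Suc_add add_Suc_right)
    then show ?thesis using i assms by (cases "j = 0"; cases "j = k"; simp)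
  qed (use i assms in simp)
  show "act n (pow Y (k - 1) @ [Yi k] @ pow X (n - k - 1) @ [H]) i
   = (if i = n then Some 1 else if i = k then Some (k + 1) else None)"
  proof (cases "k - 1 < i")
    case True
    then obtain j where "i = k - 1 + Suc j" by (metis less_iff_Suc_add add_Suc_right)
    then show ?thesis using i assms by (cases "j = 0"; cases "j = n - k"; simp)
  qed (use i assms in simp)
qed

lemma act_Vbar1_X:
  "act n [H, X] i = act n [Y, H] i"
  using n m i by auto

lemma act_Vbar1_E:
  assumes "2 \<le> k" "k \<le> (n + 1) div 2"
  shows "act n [H, E k] i = act n [E (n - k + 1), H] i"
proof -
  have "k < n" using assms n by simp
  then show ?thesis using n i assms(1) by (simp; arith)
qed

lemma act_Vbar1: assumes "(u, v) \<in> Vbar1 n m" shows "act n u i = act n v i"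
proof -
  consider "(u, v) \<in> chain [[H, X], [Y, H]]"
  | k where "k \<in> {2..(n + 1) div 2}" "(u, v) \<in> chain [[H, E k], [E (n - k + 1), H]]"
  | k where "k \<in> {1..m}" "(u, v) \<in> chain [[H, Xi k], pow Y (n - k - 1) @ [Xi k] @ pow X (k - 1) @ [H]]"
  | k where "k \<in> {1..m}" "(u, v) \<in> chain [[H, Yi k], pow Y (k - 1) @ [Yi k] @ pow X (n - k - 1) @ [H]]"
    using assms unfolding Vbar1_def by blast
  then show ?thesis
  proof cases
    case 1
    show ?thesis by (rule chain2[where f = "\<lambda>w. act n w i", OF 1 act_Vbar1_X])
  next
    case 2
    then have k: "2 \<le> k" "k \<le> (n + 1) div 2" by auto
    show ?thesis by (rule chain2[where f = "\<lambda>w. act n w i", OF 2(2) act_Vbar1_E[OF k]])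
  next
    case 3
    then have k: "1 \<le> k" "k \<le> m" by auto
    show ?thesis using act_Vbar1_Xi_Yi[OF k] by (intro chain2[where f = "\<lambda>w. act n w i", OF 3(2)]) (simp_all only:)
  next
    case 4
    then have k: "1 \<le> k" "k \<le> m" by auto
    show ?thesis using act_Vbar1_Xi_Yi[OF k] by (intro chain2[where f = "\<lambda>w. act n w i", OF 4(2)]) (simp_all only:)
  qed
qed
end

declare act_words [simp del] chain_def [simp del]

lemma relations_sound:
  assumes n: "n \<ge> 4" "m = (n - 1) div 2" and uv: "(u, v) \<in> relations n m"
  shows "act n u = act n v"
proof (rule act_eqI)
  show "u \<in> lists (alphabet n m)" "v \<in> lists (alphabet n m)"
    using relations_in_lists[OF n] uv by auto
  show m: "m < n" using n by auto
  have m': "2 * m < n" "1 \<le> m" using n by auto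
  fix i assume "1 \<le> i" "i \<le> n"
  note sound = act_V1_V4[OF n(1) m m' this] act_V5_V7[OF n(1) m m' this] act_V8[OF n(1) m m' this]
    act_V9[OF n(1) m m' this] act_V10[OF n(1) m m' this] act_V11[OF n(1) m m' this]
    act_V12[OF n(1) m m' this] act_V13[OF n(1) m m' this] act_V14[OF n(1) m m' this]
    act_Vbar0_Vbar2[OF n(1) m m' this] act_Vbar1[OF n(1) m m' this]
  show "act n u i = act n v i"
    using uv unfolding relations_def Un_iff by (elim disjE) (auto intro: sound)
qed

section \<open>Normal forms\<close>

definition point_word :: "nat \<Rightarrow> nat \<Rightarrow> letter list" where
  "point_word n i = (if i = 1 then [Y, X] else if i = n then [X, Y] else [E i])"

definition restr_word :: "nat \<Rightarrow> nat list \<Rightarrow> letter list" where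
  "restr_word n L = concat (map (point_word n) L)"

text \<open>The uniform description of \<open>x\<^sub>i\<close> and \<open>y\<^sub>i\<close> as the map \<open>1 \<mapsto> 1, p \<mapsto> q\<close>.\<close>

definition flip_letter :: "nat \<Rightarrow> nat \<Rightarrow> letter \<Rightarrow> nat \<Rightarrow> nat \<Rightarrow> bool" where
  "flip_letter n m z p q \<longleftrightarrow> (\<exists>i\<in>{1..m}.
     z = Xi i \<and> p = i + 1 \<and> q = n + 1 - i \<or> z = Yi i \<and> p = n + 1 - i \<and> q = i + 1)"

locale dims =
  fixes n m :: nat
  assumes n: "n \<ge> 4" and m: "m = (n - 1) div 2"
begin

lemma m_bounds: "m < n" "2 * m < n" "1 \<le> m"
  using n m by auto

definition trans_word :: "letter list \<Rightarrow> bool" where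
  "trans_word w \<longleftrightarrow> w \<in> lists ({X, Y} \<union> E ` {2..n - 1})"

lemma trans_word_simps [simp]:
  "trans_word []" "trans_word (X # w) \<longleftrightarrow> trans_word w" "trans_word (Y # w) \<longleftrightarrow> trans_word w"
  "trans_word (E i # w) \<longleftrightarrow> 2 \<le> i \<and> i < n \<and> trans_word w"
  "trans_word (u @ v) \<longleftrightarrow> trans_word u \<and> trans_word v"
  "trans_word (pow X k)" "trans_word (pow Y k)"
  "trans_word (es a b) \<longleftrightarrow> a > b \<or> (2 \<le> a \<and> b < n)"
  using n by (force simp: trans_word_def es_def)+

text \<open>\<open>op\<close> stands for order-preserving, which is how words without
  \<open>h\<close> act.\<close>

definition op_word :: "letter list \<Rightarrow> bool" where
  "op_word w \<longleftrightarrow> w \<in> lists (alphabet n m - {H})"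

lemma flip_letterE:
  assumes "flip_letter n m z p q"
  obtains i where "1 \<le> i" "i \<le> m" "z = Xi i" "p = i + 1" "q = n + 1 - i"
  | i where "1 \<le> i" "i \<le> m" "z = Yi i" "p = n + 1 - i" "q = i + 1"
  using assms by (auto simp: flip_letter_def)

text \<open>Both kinds of letters are two-point restrictions of the reflection
  \<open>i \<mapsto> n + 2 - i\<close> that fixes 1, whence the sum. Equality \<open>p = q\<close>
  would force \<open>2 * i = n\<close>, which \<open>2 * m < n\<close> excludes.\<close>

lemma flip_bounds:
  assumes "flip_letter n m z p q"
  shows "p \<in> {2..n}" "q \<in> {2..n}" "p \<noteq> q" "p + q = n + 2"
  using assms m_bounds by (auto elim!: flip_letterE)

text \<open>The sources of the x_i are at most \<open>m + 1\<close>, those of the y_i at least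
  \<open>n + 1 - m\<close>, and \<open>2 * m < n\<close> separates the two ranges.\<close>

lemma flip_target_unique:
  "flip_letter n m z p q \<Longrightarrow> flip_letter n m z' p q' \<Longrightarrow> z = z' \<and> q = q'"
  using m_bounds by (auto elim!: flip_letterE)

lemma op_wordD: "op_word w \<Longrightarrow> w \<in> lists (alphabet n m)"
  by (auto simp: op_word_def)

lemma trans_op_word: "trans_word w \<Longrightarrow> op_word w"
  by (auto simp: trans_word_def op_word_def alphabet_def)

lemma op_word_simps [simp]:
  "op_word []" "op_word (u @ v) \<longleftrightarrow> op_word u \<and> op_word v" "op_word (pow X k)" "op_word (pow Y k)"
  "op_word (l # w) \<longleftrightarrow> l \<in> alphabet n m - {H} \<and> op_word w"
  by (auto simp: op_word_def alphabet_def)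

lemma op_word_restr: "set L \<subseteq> {1..n} \<Longrightarrow> op_word (restr_word n L)"
  using n by (induction L) (auto simp: restr_word_def point_word_def alphabet_def)

lemma flip_in_alphabet: "flip_letter n m z p q \<Longrightarrow> z \<in> alphabet n m - {H}"
  by (auto simp: flip_letter_def alphabet_def)

lemma act_restr_word:
  "set L \<subseteq> {1..n} \<Longrightarrow> i \<in> {1..n} \<Longrightarrow>
    act n (restr_word n L @ w) i = (if i \<in> set L then None else act n w i)"
proof (induction L)
  case (Cons a L)
  then show ?case by (auto simp: restr_word_def point_word_def act_letter)
qed (simp add: restr_word_def)

lemma act_flip:
  assumes "flip_letter n m z p q"
  shows "act n (z # w) i = (if i = 1 then act n w 1 else if i = p then act n w q else None)"
  using assms by (auto elim!: flip_letterE simp: act_letter)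

text \<open>The two bounds say that no point is lost: \<open>a + p\<close> is still in
  \<open>{1..n}\<close>, and \<open>x^c\<close> is still defined at \<open>q\<close>.\<close>

lemma act_flip_word:
  assumes z: "flip_letter n m z p q" and ac: "a + p \<le> n" "c + q \<le> n"
  shows "act n (pow Y a @ [z] @ pow X c) i =
    (if i = a + 1 then Some (c + 1) else if i = a + p then Some (c + q) else None)"
proof -
  have pq: "2 \<le> p" "p \<le> n" "2 \<le> q" "q \<le> n" using flip_bounds[OF z] by auto
  have w: "op_word (pow Y a @ [z] @ pow X c)" using flip_in_alphabet[OF z] by simp
  show ?thesis
  proof (cases "i \<in> {1..n}")
    case True
    then have "act n (pow Y a @ [z] @ pow X c) i =
        (if a < i then act n (z # pow X c) (i - a) else None)"
      by (simp add: act_Y)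
    moreover have "act n (pow X c) 1 = Some (c + 1)" "act n (pow X c) q = Some (c + q)"
      using pq ac by (simp_all add: act_words)
    ultimately show ?thesis using pq act_flip[OF z] by auto
  next
    case False
    then show ?thesis using act_outside[OF op_wordD[OF w] m_bounds(1) False] pq ac by auto
  qed
qed

lemma act_append_H:
  assumes "u \<in> lists (alphabet n m)"
  shows "act n (u @ [H]) i = map_option (\<lambda>j. n + 1 - j) (act n u i)"
proof -
  have "[H] \<in> lists (alphabet n m)" by (simp add: alphabet_def)
  note * = act_append_apply[OF assms this m_bounds(1)]
  show ?thesis
    using act_bounds[OF assms m_bounds(1), of i]
    by (cases "act n u i") (auto simp: * act_letter act_Nil_apply)
qed

end

section \<open>Evaluation of words in a monoid that satisfies the relations\<close>

definition word_prod :: "(letter \<Rightarrow> 'a::monoid_mult) \<Rightarrow> letter list \<Rightarrow> 'a" where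
  "word_prod g w = prod_list (map g w)"

lemma word_prod_simps [simp]:
  "word_prod g [] = 1" "word_prod g (l # w) = g l * word_prod g w"
  "word_prod g (u @ v) = word_prod g u * word_prod g v"
  "word_prod g (pow l k) = g l ^ k"
  by (induction k) (simp_all add: word_prod_def)

text \<open>
  A typed stand-in for the quotient monoid: any evaluation of words in a monoid that satisfies the
  relations and, by \<open>sound\<close>, identifies only words with the same action.
\<close>

locale presented = dims +
  fixes g :: "letter \<Rightarrow> 'a::monoid_mult"
  assumes rel: "(u, v) \<in> relations n m \<Longrightarrow> word_prod g u = word_prod g v"
    and sound: "\<lbrakk>u \<in> lists (alphabet n m); v \<in> lists (alphabet n m);
      word_prod g u = word_prod g v\<rbrakk> \<Longrightarrow> act n u = act n v"
begin

definition "h = g H"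
definition "x = g X"
definition "y = g Y"
definition "e i = g (E i)"
definition "f i = word_prod g (point_word n i)"
definition "fs L = word_prod g (restr_word n L)"

lemma g_letters [simp]: "g H = h" "g X = x" "g Y = y" "g (E i) = e i"
  by (simp_all add: h_def x_def y_def e_def)

lemma f_cases: "f 1 = y * x" "f n = x * y" "2 \<le> i \<Longrightarrow> i < n \<Longrightarrow> f i = e i"
  "f (Suc 0) = y * x"
  using n by (simp_all add: f_def point_word_def)

lemma fs_simps [simp]: "fs [] = 1" "fs (i # L) = f i * fs L" "fs (L @ L') = fs L * fs L'"
  by (simp_all add: fs_def restr_word_def f_def)

text \<open>Relates any two members of a chain, not only neighbours, by comparing each with the
  head.\<close>

lemma chain_rel:
  assumes "chain ws \<subseteq> relations n m" "u \<in> set ws" "v \<in> set ws"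
  shows "word_prod g u = word_prod g v"
proof -
  have "\<forall>u \<in> set ws. word_prod g u = word_prod g (hd ws)" using assms(1)
  proof (induction ws rule: induct_list012)
    case (3 a b ws)
    then have "word_prod g a = word_prod g b"
      using rel[of a b] by (auto simp: chain_def)
    with 3 show ?case by (auto simp: chain_def)
  qed auto
  then show ?thesis using assms by auto
qed

text \<open>Products are nested to the right, the form that \<open>mult.assoc\<close> produces, so
  that the equations apply directly as rewrite rules.\<close>

lemma e_idem: "2 \<le> i \<Longrightarrow> i < n \<Longrightarrow> e i * e i = e i"
  and e_comm: "2 \<le> i \<Longrightarrow> i < j \<Longrightarrow> j < n \<Longrightarrow> e i * e j = e j * e i"
  and xyx: "x * (y * x) = x" and yxy: "y * (x * y) = y"
  and yxxy: "y * (x * (x * y)) = x * (y * (y * x))"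
  and xye: "2 \<le> i \<Longrightarrow> i < n \<Longrightarrow> x * (y * e i) = e i * (x * y)"
  and yxe: "2 \<le> i \<Longrightarrow> i < n \<Longrightarrow> y * (x * e i) = e i * (y * x)"
  and xe: "2 \<le> i \<Longrightarrow> i \<le> n - 2 \<Longrightarrow> x * e (i + 1) = e i * x"
  and xxy: "x * (x * y) = e (n - 1) * x" and yxx: "y * (x * x) = x * e 2"
proof -
  show "e i * e i = e i" if "2 \<le> i" "i < n"
    using chain_rel[of "[[E i, E i], [E i]]" "[E i, E i]" "[E i]"] that
    by (force simp: relations_def V1_def)
  show "e i * e j = e j * e i" if "2 \<le> i" "i < j" "j < n"
    using chain_rel[of "[[E i, E j], [E j, E i]]" "[E i, E j]" "[E j, E i]"] that
    by (force simp: relations_def V4_def)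
  show "x * (y * x) = x"
    using chain_rel[of "[[X, Y, X], [X]]" "[X, Y, X]" "[X]"] by (force simp: relations_def V2_def)
  show "y * (x * y) = y"
    using chain_rel[of "[[Y, X, Y], [Y]]" "[Y, X, Y]" "[Y]"] by (force simp: relations_def V2_def)
  show "y * (x * (x * y)) = x * (y * (y * x))"
    using chain_rel[of "[[Y, X, X, Y], [X, Y, Y, X]]" "[Y, X, X, Y]" "[X, Y, Y, X]"]
    by (force simp: relations_def V3_def)
  show "x * (y * e i) = e i * (x * y)" if "2 \<le> i" "i < n"
    using chain_rel[of "[[X, Y, E i], [E i, X, Y]]" "[X, Y, E i]" "[E i, X, Y]"] that
    by (force simp: relations_def V5_def)
  show "y * (x * e i) = e i * (y * x)" if "2 \<le> i" "i < n"
    using chain_rel[of "[[Y, X, E i], [E i, Y, X]]" "[Y, X, E i]" "[E i, Y, X]"] that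
    by (force simp: relations_def V5_def)
  show "x * e (i + 1) = e i * x" if "2 \<le> i" "i \<le> n - 2"
    using chain_rel[of "[[X, E (i + 1)], [E i, X]]" "[X, E (i + 1)]" "[E i, X]"] that
    by (force simp: relations_def V6_def)
  show "x * (x * y) = e (n - 1) * x"
    using chain_rel[of "[[X, X, Y], [E (n - 1), X]]" "[X, X, Y]" "[E (n - 1), X]"]
    by (force simp: relations_def V7_def)
  show "y * (x * x) = x * e 2"
    using chain_rel[of "[[Y, X, X], [X, E 2]]" "[Y, X, X]" "[X, E 2]"]
    by (force simp: relations_def V7_def)
qed

section \<open>Commuting idempotents and their exchange with x and y\<close>

lemma e_comm': "2 \<le> i \<Longrightarrow> i < n \<Longrightarrow> 2 \<le> j \<Longrightarrow> j < n \<Longrightarrow> e i * e j = e j * e i"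
  using e_comm[of i j] e_comm[of j i] by (cases i j rule: linorder_cases) auto

lemma point_cases:
  assumes "i \<in> {1..n}" obtains "i = 1" | "i = n" | "2 \<le> i" "i < n"
  using assms by fastforce

lemma f_idem: "i \<in> {1..n} \<Longrightarrow> f i * f i = f i"
  by (erule point_cases) (simp_all add: f_cases mult.assoc xyx yxy e_idem)

lemma f_comm: "i \<in> {1..n} \<Longrightarrow> j \<in> {1..n} \<Longrightarrow> f i * f j = f j * f i"
  by (erule point_cases; erule point_cases)
    (simp_all add: f_cases mult.assoc yxxy xye yxe e_comm')

lemma x_f1: "x * f 1 = x" and fn_x: "f n * x = x" and f1_y: "f 1 * y = y" and y_fn: "y * f n = y"
  by (simp_all only: f_cases mult.assoc xyx yxy)

text \<open>(V6) covers the inner points. The two relations of (V7) are the boundary cases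
  \<open>i = 1\<close> and \<open>i = n - 1\<close>, where one of the idempotents is
  \<open>y * x\<close> or \<open>x * y\<close>.\<close>

lemma x_f: assumes "1 \<le> i" "i < n" shows "x * f (i + 1) = f i * x"
proof -
  consider "i = 1" | "i = n - 1" | "2 \<le> i" "i \<le> n - 2" using assms by linarith
  then show ?thesis
  proof cases
    case 1
    have "f 2 = e 2" using n by (intro f_cases) auto
    then show ?thesis using 1 yxx f_cases(1) by (simp add: mult.assoc numeral_2_eq_2)
  next
    case 2
    have "f (n - 1) = e (n - 1)" using n by (intro f_cases) auto
    then show ?thesis using 2 n xxy f_cases(2) by (simp add: mult.assoc)
  next
    case 3
    then show ?thesis using xe[of i] n by (simp add: f_cases)
  qed
qed

text \<open>The relations move only \<open>x\<close> past a single idempotent \<open>E i\<close>.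
  Writing \<open>y = y * f n\<close> with \<open>f n = x * y\<close> provides an \<open>x\<close> to
  carry \<open>f i\<close> across; what is left over is \<open>f 1\<close>, which \<open>y\<close>
  absorbs.\<close>

lemma y_f: assumes "1 \<le> i" "i < n" shows "y * f i = f (i + 1) * y"
proof -
  have i: "i \<in> {1..n}" "i + 1 \<in> {1..n}" "1 \<in> {1..n}" "n \<in> {1..n}" using assms n by auto
  have "y * f i = y * (f n * f i)" by (simp add: y_fn mult.assoc[symmetric])
  also have "\<dots> = y * (f i * x) * y" using f_comm[OF i(4,1)] by (simp add: f_cases mult.assoc)
  also have "\<dots> = f 1 * f (i + 1) * y"
    unfolding x_f[OF assms, symmetric] by (simp only: f_cases(1) mult.assoc)
  also have "\<dots> = f (i + 1) * (f 1 * y)" unfolding f_comm[OF i(3,2)] by (simp only: mult.assoc)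
  finally show ?thesis by (simp only: f1_y)
qed

text \<open>The image of \<open>x^k\<close> is \<open>{k + 1..n}\<close>, so idempotents at smaller
  points are absorbed. The rules below for the other side and for \<open>y\<close> reflect domains
  and images in the same way.\<close>

lemma xk_f: "i \<in> {1..n} \<Longrightarrow> x ^ k * f i = (if i \<le> k then x ^ k else f (i - k) * x ^ k)"
proof (induction k)
  case (Suc k)
  consider "i \<le> k" | "i = Suc k" | "k + 1 < i" by linarith
  then show ?case
  proof cases
    case 3
    then obtain j where j: "i = k + 1 + j" "1 \<le> j" by (metis less_imp_add_positive One_nat_def Suc_leI)
    have "x ^ Suc k * f i = x * f (j + 1) * x ^ k" using Suc j by (simp add: mult.assoc)
    also have "\<dots> = f j * x ^ Suc k" using x_f[of j] j Suc.prems by (simp add: mult.assoc)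
    finally show ?thesis using j by simp
  next
    case 2
    then show ?thesis using Suc x_f1 by (simp add: mult.assoc) (simp add: mult.assoc[symmetric])
  qed (use Suc in \<open>simp add: mult.assoc\<close>)
qed auto

lemma f_xk: "i \<in> {1..n} \<Longrightarrow> n < i + k \<Longrightarrow> f i * x ^ k = x ^ k"
proof (induction k arbitrary: i)
  case (Suc k)
  show ?case
  proof (cases "i = n")
    case True
    then show ?thesis by (simp add: fn_x mult.assoc[symmetric])
  next
    case False
    then have "f i * x = x * f (i + 1)" using x_f[of i] Suc.prems by simp
    then have "f i * x ^ Suc k = x * (f (i + 1) * x ^ k)" by (simp add: mult.assoc[symmetric])
    also have "\<dots> = x * x ^ k" using Suc.IH[of "i + 1"] Suc.prems False by simp
    finally show ?thesis by simp
  qed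
qed auto

lemma f_yk: "i \<in> {1..n} \<Longrightarrow> f i * y ^ k = (if i \<le> k then y ^ k else y ^ k * f (i - k))"
proof (induction k)
  case (Suc k)
  have *: "f i * y ^ Suc k = (f i * y ^ k) * y" by (simp only: power_Suc2 mult.assoc)
  consider "i \<le> k" | "i = Suc k" | "k + 1 < i" by linarith
  then show ?case
  proof cases
    case 1
    then show ?thesis using * Suc by (simp add: power_commutes)
  next
    case 2
    have "y ^ k * f 1 * y = y ^ k * y" by (simp only: mult.assoc f1_y)
    then show ?thesis using * 2 Suc by (simp add: power_commutes)
  next
    case 3
    then obtain j where j: "i = k + 1 + j" "1 \<le> j" by (metis less_imp_add_positive One_nat_def Suc_leI)
    have "y ^ k * f (Suc j) * y = y ^ k * y * f j"
      using y_f[of j] j Suc.prems by (simp add: mult.assoc)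
    then show ?thesis using * Suc j by (simp add: power_commutes)
  qed
qed auto

lemma yk_f_id: "i \<in> {1..n} \<Longrightarrow> n < i + k \<Longrightarrow> y ^ k * f i = y ^ k"
proof (induction k arbitrary: i)
  case (Suc k)
  have *: "y ^ Suc k * f i = y ^ k * (y * f i)" by (simp only: power_Suc2 mult.assoc)
  show ?case
  proof (cases "i = n")
    case True
    then show ?thesis using * by (simp add: y_fn power_commutes)
  next
    case False
    then have "y * f i = f (i + 1) * y" using y_f[of i] Suc.prems by simp
    then have "y ^ Suc k * f i = y ^ k * f (i + 1) * y" using * by (simp add: mult.assoc)
    also have "\<dots> = y ^ k * y" using Suc.IH[of "i + 1"] Suc.prems False by simp
    finally show ?thesis by (simp add: power_commutes)
  qed
qed auto

lemma yk_f: "i \<in> {1..n} \<Longrightarrow> y ^ k * f i = (if n < i + k then y ^ k else f (i + k) * y ^ k)"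
  using yk_f_id[of i k] f_yk[of "i + k" k] by auto

lemma fs_comm: "i \<in> {1..n} \<Longrightarrow> set L \<subseteq> {1..n} \<Longrightarrow> f i * fs L = fs L * f i"
proof (induction L)
  case (Cons a L)
  then show ?case using f_comm[of i a] by (simp add: mult.assoc[symmetric]) (simp add: mult.assoc)
qed auto

lemma fs_absorb1: "set L \<subseteq> {1..n} \<Longrightarrow> i \<in> set L \<Longrightarrow> fs L * f i = fs L"
proof (induction L)
  case (Cons a L)
  show ?case
  proof (cases "i \<in> set L")
    case True
    then show ?thesis using Cons by (simp add: mult.assoc)
  next
    case False
    then have i: "a = i" "i \<in> {1..n}" "set L \<subseteq> {1..n}" using Cons.prems by auto
    have "fs (a # L) * f i = f i * (f i * fs L)" by (simp only: fs_simps i(1) mult.assoc fs_comm[OF i(2,3), symmetric])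
    also have "\<dots> = fs (a # L)" using f_idem[OF i(2)] i(1) by (simp add: mult.assoc[symmetric])
    finally show ?thesis .
  qed
qed auto

lemma fs_absorb: "set L \<subseteq> {1..n} \<Longrightarrow> set L' \<subseteq> set L \<Longrightarrow> fs L * fs L' = fs L"
proof (induction L')
  case (Cons a L')
  then show ?case using fs_absorb1[of L a] by (simp add: mult.assoc[symmetric])
qed auto

lemma fs_comm2: "set L \<subseteq> {1..n} \<Longrightarrow> set L' \<subseteq> {1..n} \<Longrightarrow> fs L * fs L' = fs L' * fs L"
proof (induction L)
  case (Cons a L)
  then show ?case using fs_comm[of a L'] by (simp add: mult.assoc) (simp add: mult.assoc[symmetric])
qed auto

text \<open>Each product absorbs the other, and the two commute.\<close>

lemma fs_cong: "set L = set L' \<Longrightarrow> set L \<subseteq> {1..n} \<Longrightarrow> fs L = fs L'"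
  using fs_absorb[of L L'] fs_absorb[of L' L] fs_comm2[of L L'] by auto

lemma fs_es: "2 \<le> a \<Longrightarrow> b < n \<Longrightarrow> word_prod g (es a b) = fs [a..<Suc b]"
proof (induction b)
  case (Suc b)
  show ?case
  proof (cases "a \<le> Suc b")
    case True
    then have "es a (Suc b) = es a b @ [E (Suc b)]" by (simp add: es_def)
    then show ?thesis using Suc True f_cases(3)[of "Suc b"] by simp
  qed (simp add: es_def)
qed (simp add: es_def)

lemma x_fs: "set L \<subseteq> {1..<n} \<Longrightarrow> x * fs (map Suc L) = fs L * x"
proof (induction L)
  case (Cons a L)
  then show ?case using x_f[of a] by (simp add: mult.assoc[symmetric]) (simp add: mult.assoc)
qed auto

text \<open>The idempotent with domain \<open>{1}\<close>, not a value of \<open>e\<close>. All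
  chains of (V14) end in it.\<close>

definition "e1 = word_prod g (es 2 (n - 1) @ [X, Y])"

lemma e1_eq: "e1 = fs [2..<Suc n]"
  using n fs_es[of 2 "n - 1"] f_cases(2) by (simp add: e1_def)

definition "zero = fs [1..<Suc n]"

text \<open>\<open>zero\<close> is the empty map. (V8) reads \<open>f 1 * e1 = x * e1\<close>: its
  left side is \<open>zero\<close>, and carrying the idempotents of \<open>e1\<close> to the left of
  \<open>x\<close> turns the other side into \<open>fs [1..<n] * x\<close>. From this
  \<open>zero\<close> absorbs \<open>x\<close> and \<open>y\<close>.\<close>

lemma zero_eq: "zero = fs [1..<n] * x"
proof -
  have "word_prod g ([Y, X] @ es 2 (n - 1) @ [X, Y]) = word_prod g ([X] @ es 2 (n - 1) @ [X, Y])"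
    by (rule chain_rel[where ws = "[[Y, X] @ es 2 (n - 1) @ [X, Y], [X] @ es 2 (n - 1) @ [X, Y]]"])
      (auto simp: relations_def V8_def)
  then have "f 1 * e1 = x * e1" by (simp add: e1_def f_cases mult.assoc)
  moreover have "f 1 * e1 = zero"
  proof -
    have "[1..<Suc n] = 1 # [2..<Suc n]" using n upt_conv_Cons[of 1 "Suc n"] by (simp only: Suc_1)
    then show ?thesis by (simp only: e1_eq zero_def fs_simps)
  qed
  moreover have "x * e1 = fs [1..<n] * x"
    using x_fs[of "[1..<n]"] by (simp add: e1_eq map_Suc_upt numeral_2_eq_2)
  ultimately show ?thesis by simp
qed

lemma zero_x: "zero * x ^ k = zero"
proof (induction k)
  case (Suc k)
  have "zero * x = fs [1..<n] * (f n * x)" using n by (simp add: zero_def mult.assoc)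
  also have "\<dots> = zero" by (simp add: zero_eq fn_x)
  finally show ?case using Suc by (simp add: mult.assoc[symmetric])
qed auto

lemma zero_y: "zero * y ^ k = zero"
proof (induction k)
  case (Suc k)
  have "zero * y = fs [1..<n] * (x * y)" by (simp add: zero_eq mult.assoc)
  also have "\<dots> = zero" using n by (simp add: zero_def f_cases)
  finally show ?case using Suc by (simp add: mult.assoc[symmetric])
qed auto

section \<open>Partial translations under right multiplication\<close>

definition trans_elem :: "'a \<Rightarrow> bool" where
  "trans_elem v \<longleftrightarrow> (\<exists>L k. set L \<subseteq> {1..n} \<and> (v = fs L * x ^ k \<or> v = fs L * y ^ k))"

lemma trans_elem_fs_x: "set L \<subseteq> {1..n} \<Longrightarrow> trans_elem (fs L * x ^ k)"
  and trans_elem_fs_y: "set L \<subseteq> {1..n} \<Longrightarrow> trans_elem (fs L * y ^ k)"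
  by (auto simp: trans_elem_def)

lemma trans_elem_1: "trans_elem 1"
  using trans_elem_fs_x[of "[]" 0] by simp

lemma trans_elem_f:
  assumes "trans_elem v" "i \<in> {1..n}" shows "trans_elem (v * f i)"
proof -
  obtain L k where L: "set L \<subseteq> {1..n}" and v: "v = fs L * x ^ k \<or> v = fs L * y ^ k"
    using assms(1) by (auto simp: trans_elem_def)
  from v show ?thesis
  proof
    assume v: "v = fs L * x ^ k"
    show ?thesis
    proof (cases "i \<le> k")
      case True
      then show ?thesis using v xk_f[of i k] assms by (simp add: mult.assoc)
    next
      case False
      then have "v * f i = fs (L @ [i - k]) * x ^ k"
        using v xk_f[of i k] assms by (simp add: mult.assoc)
      moreover have "trans_elem (fs (L @ [i - k]) * x ^ k)"
        using L False assms(2) by (intro trans_elem_fs_x) auto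
      ultimately show ?thesis by simp
    qed
  next
    assume v: "v = fs L * y ^ k"
    show ?thesis
    proof (cases "n < i + k")
      case True
      then show ?thesis using v yk_f[of i k] assms by (simp add: mult.assoc)
    next
      case False
      then have "v * f i = fs (L @ [i + k]) * y ^ k"
        using v yk_f[of i k] assms by (simp add: mult.assoc)
      moreover have "trans_elem (fs (L @ [i + k]) * y ^ k)"
        using L False assms(2) by (intro trans_elem_fs_y) auto
      ultimately show ?thesis by simp
    qed
  qed
qed

lemma trans_elem_x:
  assumes "trans_elem v" shows "trans_elem (v * x)"
proof -
  obtain L k where L: "set L \<subseteq> {1..n}" and v: "v = fs L * x ^ k \<or> v = fs L * y ^ k"
    using assms(1) by (auto simp: trans_elem_def)
  \<comment> \<open>Only a positive power of \<open>y\<close> before \<open>x\<close> changes its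
    shape: its last \<open>y\<close> together with \<open>x\<close> is \<open>f 1\<close>, which a
    translation can take up.\<close>
  consider "v * x = fs L * x ^ Suc k" | "k = 0" "v = fs L" | j where "v = fs L * y ^ Suc j"
    using v by (cases k) (auto simp: mult.assoc power_commutes)
  then show ?thesis
  proof cases
    case 1
    then show ?thesis using L trans_elem_fs_x by metis
  next
    case 2
    then show ?thesis using L trans_elem_fs_x[of L 1] by simp
  next
    case 3
    then have "v * x = fs L * y ^ j * f 1"
      by (simp add: f_cases mult.assoc power_Suc2 del: power_Suc)
    moreover have "1 \<in> {1..n}" using n by simp
    ultimately show ?thesis using trans_elem_f[OF trans_elem_fs_y[OF L, of j]] by metis
  qed
qed

lemma trans_elem_y:
  assumes "trans_elem v" shows "trans_elem (v * y)"
proof -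
  obtain L k where L: "set L \<subseteq> {1..n}" and v: "v = fs L * x ^ k \<or> v = fs L * y ^ k"
    using assms(1) by (auto simp: trans_elem_def)
  consider "v * y = fs L * y ^ Suc k" | "k = 0" "v = fs L" | j where "v = fs L * x ^ Suc j"
    using v by (cases k) (auto simp: mult.assoc power_commutes)
  then show ?thesis
  proof cases
    case 1
    then show ?thesis using L trans_elem_fs_y by metis
  next
    case 2
    then show ?thesis using L trans_elem_fs_y[of L 1] by simp
  next
    case 3
    then have "v * y = fs L * x ^ j * f n"
      by (simp add: f_cases mult.assoc power_Suc2 del: power_Suc)
    moreover have "n \<in> {1..n}" using n by simp
    ultimately show ?thesis using trans_elem_f[OF trans_elem_fs_x[OF L, of j]] by metis
  qed
qed

lemma trans_elem_word:
  assumes "trans_elem v" "trans_word w" shows "trans_elem (v * word_prod g w)"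
  using assms
proof (induction w arbitrary: v)
  case (Cons l w)
  have "trans_elem (v * g l)"
    using Cons.prems trans_elem_x[of v] trans_elem_y[of v] trans_elem_f[of v] f_cases(3)[symmetric]
    by (auto simp: trans_word_def)
  then show ?case using Cons by (auto simp: trans_word_def mult.assoc[symmetric])
qed auto

section \<open>Products with the letters x_i and y_i\<close>

lemma flip_f:
  assumes z: "flip_letter n m z p q" and j: "2 \<le> j" "j \<le> n"
  shows "g z * f j = (if j = q then e1 else g z)"
  using z
proof (cases rule: flip_letterE)
  case (1 i)
  \<comment> \<open>x_1 is exceptional: its image point is \<open>n\<close>, and the idempotent
    deleting \<open>n\<close> is \<open>x * y\<close> rather than a letter. Hence its separate chain
    in (V14).\<close>
  show ?thesis
  proof (cases "i = 1")
    case True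
    have "word_prod g [Xi 1, X, Y] = e1" unfolding e1_def
      by (rule chain_rel[where ws = "[[Xi 1, X, Y], [E 2, Xi 1], [Yi 1, E 2], [X, Y, Yi 1], es 2 (n - 1) @ [X, Y]]"])
        (auto simp: relations_def V14_def)
    moreover have "word_prod g [Xi 1, E j] = word_prod g [Xi 1]" if "j < n"
      using that True j 1 by (intro chain_rel[where ws = "[[Xi 1, E j], [Xi 1]]"])
        (force simp: relations_def V10_def)+
    ultimately show ?thesis using True 1 j f_cases(2) f_cases(3)[of j] by auto
  next
    case False
    have "word_prod g [Xi i, E (n - i + 1)] = e1" unfolding e1_def
      using 1 False m_bounds
      by (intro chain_rel[where ws = "[[Xi i, E (n - i + 1)], [E (i + 1), Xi i], [Yi i, E (i + 1)],
          [E (n - i + 1), Yi i], es 2 (n - 1) @ [X, Y]]"])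
        (force simp: relations_def V14_def)+
    moreover have "word_prod g [Xi i, E j] = word_prod g [Xi i]" if "j < n" "j \<noteq> n - i + 1"
      using that False j 1 by (intro chain_rel[where ws = "[[Xi i, E j], [Xi i]]"])
        (force simp: relations_def V10_def)+
    moreover have "word_prod g [Xi i, X, Y] = word_prod g [Xi i]"
      using False 1 by (intro chain_rel[where ws = "[[Xi i, X, Y], [X, Y, Xi i], [Xi i]]"])
        (force simp: relations_def V12_def)+
    moreover have "n + 1 - i = n - i + 1" "n - i + 1 < n" using 1 False m_bounds by auto
    ultimately show ?thesis using False 1 j f_cases(2) f_cases(3)[of j] by (cases "j = n") auto
  qed
next
  case (2 i)
  have "word_prod g [Yi i, E (i + 1)] = e1" unfolding e1_def
  proof (cases "i = 1")
    case True
    have "word_prod g [Yi 1, E 2] = word_prod g (es 2 (n - 1) @ [X, Y])"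
      by (rule chain_rel[where ws = "[[Xi 1, X, Y], [E 2, Xi 1], [Yi 1, E 2], [X, Y, Yi 1], es 2 (n - 1) @ [X, Y]]"])
        (auto simp: relations_def V14_def)
    then show "word_prod g [Yi i, E (i + 1)] = word_prod g (es 2 (n - 1) @ [X, Y])"
      using True by (simp add: numeral_2_eq_2)
  next
    case False
    then show "word_prod g [Yi i, E (i + 1)] = word_prod g (es 2 (n - 1) @ [X, Y])"
      using 2 m_bounds
      by (intro chain_rel[where ws = "[[Xi i, E (n - i + 1)], [E (i + 1), Xi i], [Yi i, E (i + 1)],
          [E (n - i + 1), Yi i], es 2 (n - 1) @ [X, Y]]"])
        (force simp: relations_def V14_def)+
  qed
  moreover have "word_prod g [Yi i, E j] = word_prod g [Yi i]" if "j < n" "j \<noteq> i + 1"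
    using that j 2 by (intro chain_rel[where ws = "[[Yi i, E j], [Yi i]]"])
      (force simp: relations_def V11_def)+
  moreover have "word_prod g [Yi i, X, Y] = word_prod g [Yi i]"
  proof (cases "i = 1")
    case True
    then show ?thesis by (intro chain_rel[where ws = "[[Yi 1, X, Y], [Yi 1]]"])
        (force simp: relations_def V12_def)+
  next
    case False
    then show ?thesis using 2 by (intro chain_rel[where ws = "[[X, Y, Yi i], [Yi i, X, Y], [Yi i]]"])
        (force simp: relations_def V12_def)+
  qed
  moreover have "i + 1 < n" using 2 m_bounds by auto
  ultimately show ?thesis using 2 j f_cases(2) f_cases(3)[of j] by (cases "j = n") auto
qed

lemma f_flip:
  assumes z: "flip_letter n m z p q" and j: "2 \<le> j" "j \<le> n"
  shows "f j * g z = (if j = p then e1 else g z)"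
  using z
proof (cases rule: flip_letterE)
  case (2 i)
  \<comment> \<open>Dually, y_1 is exceptional on this side, since its source is
    \<open>n\<close>.\<close>
  show ?thesis
  proof (cases "i = 1")
    case True
    have "word_prod g [X, Y, Yi 1] = e1" unfolding e1_def
      by (rule chain_rel[where ws = "[[Xi 1, X, Y], [E 2, Xi 1], [Yi 1, E 2], [X, Y, Yi 1], es 2 (n - 1) @ [X, Y]]"])
        (auto simp: relations_def V14_def)
    moreover have "word_prod g [E j, Yi 1] = word_prod g [Yi 1]" if "j < n"
      using that True j 2 by (intro chain_rel[where ws = "[[E j, Yi 1], [Yi 1]]"])
        (force simp: relations_def V10_def)+
    ultimately show ?thesis using True 2 j f_cases(2) f_cases(3)[of j] by (auto simp: mult.assoc)
  next
    case False
    have "word_prod g [E (n - i + 1), Yi i] = e1" unfolding e1_def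
      using 2 False m_bounds
      by (intro chain_rel[where ws = "[[Xi i, E (n - i + 1)], [E (i + 1), Xi i], [Yi i, E (i + 1)],
          [E (n - i + 1), Yi i], es 2 (n - 1) @ [X, Y]]"])
        (force simp: relations_def V14_def)+
    moreover have "word_prod g [E j, Yi i] = word_prod g [Yi i]" if "j < n" "j \<noteq> n - i + 1"
      using that False j 2 by (intro chain_rel[where ws = "[[E j, Yi i], [Yi i]]"])
        (force simp: relations_def V10_def)+
    moreover have "word_prod g [X, Y, Yi i] = word_prod g [Yi i]"
      using False 2 by (intro chain_rel[where ws = "[[X, Y, Yi i], [Yi i, X, Y], [Yi i]]"])
        (force simp: relations_def V12_def)+
    moreover have "n + 1 - i = n - i + 1" "n - i + 1 < n" using 2 False m_bounds by auto
    ultimately show ?thesis using False 2 j f_cases(2) f_cases(3)[of j]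
      by (cases "j = n") (auto simp: mult.assoc)
  qed
next
  case (1 i)
  have "word_prod g [E (i + 1), Xi i] = e1" unfolding e1_def
  proof (cases "i = 1")
    case True
    have "word_prod g [E 2, Xi 1] = word_prod g (es 2 (n - 1) @ [X, Y])"
      by (rule chain_rel[where ws = "[[Xi 1, X, Y], [E 2, Xi 1], [Yi 1, E 2], [X, Y, Yi 1], es 2 (n - 1) @ [X, Y]]"])
        (auto simp: relations_def V14_def)
    then show "word_prod g [E (i + 1), Xi i] = word_prod g (es 2 (n - 1) @ [X, Y])"
      using True by (simp add: numeral_2_eq_2)
  next
    case False
    then show "word_prod g [E (i + 1), Xi i] = word_prod g (es 2 (n - 1) @ [X, Y])"
      using 1 m_bounds
      by (intro chain_rel[where ws = "[[Xi i, E (n - i + 1)], [E (i + 1), Xi i], [Yi i, E (i + 1)],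
          [E (n - i + 1), Yi i], es 2 (n - 1) @ [X, Y]]"])
        (force simp: relations_def V14_def)+
  qed
  moreover have "word_prod g [E j, Xi i] = word_prod g [Xi i]" if "j < n" "j \<noteq> i + 1"
    using that j 1 by (intro chain_rel[where ws = "[[E j, Xi i], [Xi i]]"])
      (force simp: relations_def V11_def)+
  moreover have "word_prod g [X, Y, Xi i] = word_prod g [Xi i]"
  proof (cases "i = 1")
    case True
    then show ?thesis by (intro chain_rel[where ws = "[[X, Y, Xi 1], [Xi 1]]"])
        (force simp: relations_def V12_def)+
  next
    case False
    then show ?thesis using 1 by (intro chain_rel[where ws = "[[Xi i, X, Y], [X, Y, Xi i], [Xi i]]"])
        (force simp: relations_def V12_def)+
  qed
  moreover have "i + 1 < n" using 1 m_bounds by auto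
  ultimately show ?thesis using 1 j f_cases(2) f_cases(3)[of j]
    by (cases "j = n") (auto simp: mult.assoc)
qed

text \<open>As 1 is fixed, deleting it before or after the letter leaves the same map
  \<open>p \<mapsto> q\<close>, a partial translation. The existential form keeps the long words of
  (V13) out of later computations.\<close>

lemma flip_f1:
  assumes z: "flip_letter n m z p q"
  obtains w where "trans_word w" "g z * f 1 = word_prod g w" "f 1 * g z = word_prod g w"
  using z
proof (cases rule: flip_letterE)
  case (1 i)
  show ?thesis
  proof (cases "i = 1")
    case True
    let ?ws = "[[Y, X, Xi 1], [Xi 1, Y, X], pow X (n - 2) @ [E (n - 1)]]"
    have *: "chain ?ws \<subseteq> relations n m" by (auto simp: relations_def V13_def)
    show ?thesis
    proof (rule that[of "pow X (n - 2) @ [E (n - 1)]"])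
      show "trans_word (pow X (n - 2) @ [E (n - 1)])" using n by simp
      show "g z * f 1 = word_prod g (pow X (n - 2) @ [E (n - 1)])"
        using chain_rel[OF *, of "[Xi 1, Y, X]" "pow X (n - 2) @ [E (n - 1)]"] True 1
        by (simp add: f_cases)
      show "f 1 * g z = word_prod g (pow X (n - 2) @ [E (n - 1)])"
        using chain_rel[OF *, of "[Y, X, Xi 1]" "pow X (n - 2) @ [E (n - 1)]"] True 1
        by (simp add: f_cases mult.assoc)
    qed
  next
    case False
    let ?w = "pow X (n - 2 * i) @ es (n - 2 * i + 1) (n - i) @ es (n - i + 2) (n - 1) @ [X, Y]"
    let ?ws = "[[Y, X, Xi i], [Xi i, Y, X], ?w]"
    have *: "chain ?ws \<subseteq> relations n m" using 1 False by (force simp: relations_def V13_def)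
    show ?thesis
    proof (rule that[of ?w])
      show "trans_word ?w" using n m_bounds 1 by auto
      show "g z * f 1 = word_prod g ?w"
        using chain_rel[OF *, of "[Xi i, Y, X]" ?w] 1 by (simp add: f_cases)
      show "f 1 * g z = word_prod g ?w"
        using chain_rel[OF *, of "[Y, X, Xi i]" ?w] 1 by (simp add: f_cases mult.assoc)
    qed
  qed
next
  case (2 i)
  let ?w = "pow Y (n - 2 * i + 1) @ [X] @ es 2 i @ es (i + 2) (2 * i)"
  let ?ws = "[[Y, X, Yi i], [Yi i, Y, X], ?w]"
  have *: "chain ?ws \<subseteq> relations n m" using 2 by (force simp: relations_def V13_def)
  show ?thesis
  proof (rule that[of ?w])
    show "trans_word ?w" using n m_bounds 2 by auto
    show "g z * f 1 = word_prod g ?w"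
      using chain_rel[OF *, of "[Yi i, Y, X]" ?w] 2 by (simp add: f_cases)
    show "f 1 * g z = word_prod g ?w"
      using chain_rel[OF *, of "[Y, X, Yi i]" ?w] 2 by (simp add: f_cases mult.assoc)
  qed
qed

lemma e1_word: "trans_word (es 2 (n - 1) @ [X, Y])"
  using n by simp

text \<open>By \<open>flip_target_unique\<close> the second letter must be the inverse of the first,
  so (V9) applies; the product is the idempotent with domain \<open>{1, p}\<close>.\<close>

lemma flip_flip_inverse:
  assumes "flip_letter n m z p q" "flip_letter n m z' q q'"
  obtains w where "trans_word w" "g z * g z' = word_prod g w"
  using assms(1)
proof (cases rule: flip_letterE)
  case (1 i)
  then have "flip_letter n m (Yi i) q p" by (auto simp: flip_letter_def)
  then have z': "z' = Yi i" using flip_target_unique assms(2) by blast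
  let ?w = "es 2 i @ es (i + 2) (n - 1) @ [X, Y]"
  have "word_prod g [Xi i, Yi i] = word_prod g ?w"
    using 1 by (intro chain_rel[where ws = "[[Xi i, Yi i], ?w]"]) (force simp: relations_def V9_def)+
  moreover have "trans_word ?w" using 1 m_bounds by auto
  ultimately show ?thesis using that[of ?w] z' 1 by simp
next
  case (2 i)
  then have "flip_letter n m (Xi i) q p" by (auto simp: flip_letter_def)
  then have z': "z' = Xi i" using flip_target_unique assms(2) by blast
  show ?thesis
  proof (cases "i = 1")
    case True
    let ?w = "es 2 (n - 1)"
    have "word_prod g [Yi 1, Xi 1] = word_prod g ?w"
      by (intro chain_rel[where ws = "[[Yi 1, Xi 1], ?w]"]) (force simp: relations_def V9_def)+
    moreover have "trans_word ?w" using n by auto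
    ultimately show ?thesis using that[of ?w] z' 2 True by simp
  next
    case False
    let ?w = "es 2 (n - i) @ es (n - i + 2) (n - 1) @ [X, Y]"
    have "word_prod g [Yi i, Xi i] = word_prod g ?w"
      using 2 False by (intro chain_rel[where ws = "[[Yi i, Xi i], ?w]"]) (force simp: relations_def V9_def)+
    moreover have "trans_word ?w" using 2 m_bounds False by auto
    ultimately show ?thesis using that[of ?w] z' 2 by simp
  qed
qed

text \<open>The bounds keep both points of the letter alive, so the second form has rank 2 and its
  parameters can be read off the action. A word violating a bound collapses to a
  translation.\<close>

definition normal_elem :: "'a \<Rightarrow> bool" where
  "normal_elem v \<longleftrightarrow> trans_elem v \<or>
     (\<exists>a c z p q. flip_letter n m z p q \<and> a + p \<le> n \<and> c + q \<le> n \<and> v = y ^ a * g z * x ^ c)"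

lemma normal_elem_word:
  assumes "trans_elem v" "trans_word w" "v' = v * word_prod g w" shows "normal_elem v'"
  using trans_elem_word[OF assms(1,2)] assms(3) by (simp add: normal_elem_def)

lemma trans_elem_yk: "trans_elem (y ^ k)"
  using trans_elem_fs_y[of "[]" k] by simp

lemma normal_elem_f:
  assumes v: "normal_elem v" and j: "j \<in> {1..n}"
  shows "normal_elem (v * f j)"
  using v unfolding normal_elem_def[of v]
proof (elim disjE exE conjE)
  fix a c z p q
  assume z: "flip_letter n m z p q" and ac: "a + p \<le> n" "c + q \<le> n" and v: "v = y ^ a * g z * x ^ c"
  show "normal_elem (v * f j)"
  proof (cases "j \<le> c")
    case True
    then show ?thesis using v xk_f[OF j] z ac unfolding normal_elem_def
      by (simp add: mult.assoc) blast
  next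
    case False
    then have *: "v * f j = y ^ a * (g z * f (j - c)) * x ^ c"
      using v xk_f[OF j, of c] by (simp add: mult.assoc)
    obtain w where w: "trans_word w" "g z * f 1 = word_prod g w" using flip_f1[OF z] by blast
    \<comment> \<open>Having passed \<open>x^c\<close>, the idempotent sits at \<open>j - c\<close>:
      at 1 it makes the letter a translation, at \<open>q\<close> it makes it \<open>e1\<close>, and
      elsewhere it is absorbed.\<close>
    consider "j - c = 1" | "j - c = q" "2 \<le> j - c" | "2 \<le> j - c" "j - c \<noteq> q" using False by linarith
    then show ?thesis
    proof cases
      case 1
      show ?thesis
        by (rule normal_elem_word[OF trans_elem_yk[of a], of "w @ pow X c"])
          (use w * 1 in \<open>auto simp: mult.assoc\<close>)
    next
      case 2
      then have "v * f j = y ^ a * e1 * x ^ c" using * flip_f[OF z, of "j - c"] flip_bounds[OF z] by simp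
      then show ?thesis
        by (intro normal_elem_word[OF trans_elem_yk[of a], of "(es 2 (n - 1) @ [X, Y]) @ pow X c"])
          (use e1_word in \<open>simp_all add: e1_def mult.assoc\<close>)
    next
      case 3
      moreover have "j - c \<le> n" using j by auto
      ultimately have "v * f j = v" using * flip_f[OF z, of "j - c"] v by simp
      then show ?thesis using assms(1) by simp
    qed
  qed
qed (use j trans_elem_f in \<open>auto simp: normal_elem_def\<close>)

lemma normal_elem_x:
  assumes "normal_elem v" shows "normal_elem (v * x)"
  using assms unfolding normal_elem_def[of v]
proof (elim disjE exE conjE)
  fix a c z p q
  assume z: "flip_letter n m z p q" and ac: "a + p \<le> n" "c + q \<le> n" and v: "v = y ^ a * g z * x ^ c"
  then have vx: "v * x = y ^ a * (g z * x ^ Suc c)" by (simp add: mult.assoc power_commutes)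
  show "normal_elem (v * x)"
  proof (cases "Suc c + q \<le> n")
    case True
    then show ?thesis using vx z ac unfolding normal_elem_def by (metis mult.assoc)
  next
    case False
    \<comment> \<open>The power is undefined at \<open>q\<close>, so \<open>f q\<close> can be
      inserted before it; this turns the letter into \<open>e1\<close>.\<close>
    have "x ^ Suc c = f q * x ^ Suc c" using f_xk[of q "Suc c"] False flip_bounds[OF z] by auto
    then have "v * x = y ^ a * (g z * f q) * x ^ Suc c" using vx by (simp only: mult.assoc)
    also have "\<dots> = y ^ a * e1 * x ^ Suc c" using flip_f[OF z, of q] flip_bounds[OF z] by simp
    finally show ?thesis
      by (intro normal_elem_word[OF trans_elem_yk[of a], of "(es 2 (n - 1) @ [X, Y]) @ pow X (Suc c)"])
        (use e1_word in \<open>simp_all add: e1_def mult.assoc\<close>)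
  qed
qed (use trans_elem_x in \<open>auto simp: normal_elem_def\<close>)

lemma normal_elem_y:
  assumes "normal_elem v" shows "normal_elem (v * y)"
  using assms unfolding normal_elem_def[of v]
proof (elim disjE exE conjE)
  fix a c z p q
  assume z: "flip_letter n m z p q" and ac: "a + p \<le> n" "c + q \<le> n" and v: "v = y ^ a * g z * x ^ c"
  show "normal_elem (v * y)"
  proof (cases c)
    case 0
    obtain w where w: "trans_word w" "g z * f 1 = word_prod g w" using flip_f1[OF z] by blast
    \<comment> \<open>\<open>y\<close> is undefined at 1, so \<open>f 1\<close> can be inserted
      between the letter and \<open>y\<close>.\<close>
    have "v * y = y ^ a * (g z * f 1) * y" using v 0 f1_y by (simp only: mult.assoc) simp
    also have "\<dots> = y ^ a * word_prod g w * y" using w by simp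
    finally show ?thesis
      by (intro normal_elem_word[OF trans_elem_yk[of a], of "w @ [Y]"])
        (use w(1) in \<open>simp_all add: mult.assoc\<close>)
  next
    case (Suc d)
    have "v * y = (y ^ a * g z * x ^ d) * f n"
      using v Suc by (simp add: f_cases mult.assoc power_Suc2 del: power_Suc)
    moreover have "normal_elem (y ^ a * g z * x ^ d)"
      using z ac Suc unfolding normal_elem_def by (metis Suc_leD add_Suc)
    ultimately show ?thesis using normal_elem_f[of _ n] n by simp
  qed
qed (use trans_elem_y in \<open>auto simp: normal_elem_def\<close>)

lemma normal_elem_trans_word:
  assumes "normal_elem v" "trans_word w" shows "normal_elem (v * word_prod g w)"
  using assms
proof (induction w arbitrary: v)
  case (Cons l w)
  have "normal_elem (v * g l)"
    using Cons.prems normal_elem_x[of v] normal_elem_y[of v] normal_elem_f[of v] f_cases(3)[symmetric]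
    by (auto simp: trans_word_def)
  then show ?case using Cons by (auto simp: trans_word_def mult.assoc[symmetric])
qed auto

text \<open>Idempotents at points other than 1 and \<open>p\<close> disappear into the letter. If 1
  or \<open>p\<close> occurs in \<open>L\<close>, absorption inside \<open>fs L\<close> supplies an
  extra copy of that idempotent beside the letter, which makes it a translation.\<close>

lemma fs_flip:
  assumes z: "flip_letter n m z p q" and L: "set L \<subseteq> {1..n}"
  shows "fs L * g z = g z \<or> (\<exists>w. trans_word w \<and> fs L * g z = word_prod g w)"
proof (cases "1 \<in> set L \<or> p \<in> set L")
  case False
  then have "fs L * g z = g z" using L
  proof (induction L)
    case (Cons a L)
    then show ?case using f_flip[OF z, of a] by (auto simp: mult.assoc)
  qed simp
  then show ?thesis ..
next
  case True
  obtain w where w: "trans_word w" "f 1 * g z = word_prod g w" using flip_f1[OF z] by blast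
  have pw: "trans_word (point_word n i)" if "i \<in> {1..n}" for i
    using that n by (auto simp: point_word_def)
  have fw: "trans_word (restr_word n L)"
    using L pw by (induction L) (auto simp: restr_word_def)
  have "\<exists>j w'. j \<in> set L \<and> trans_word w' \<and> f j * g z = word_prod g w'"
  proof (cases "1 \<in> set L")
    case False
    have "f p * g z = word_prod g (es 2 (n - 1) @ [X, Y])"
      using f_flip[OF z, of p] flip_bounds[OF z] unfolding e1_def by auto
    then show ?thesis using True False e1_word by blast
  qed (use w in blast)
  then obtain j w' where j: "j \<in> set L" "trans_word w'" "f j * g z = word_prod g w'" by blast
  have "fs L * g z = fs L * (f j * g z)"
    using fs_absorb1[OF L j(1)] by (simp add: mult.assoc[symmetric])
  also have "\<dots> = word_prod g (restr_word n L @ w')" by (simp add: j(3) fs_def)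
  finally show ?thesis using fw j(2) by (metis trans_word_simps(5))
qed

text \<open>The rank 2 normal form has no idempotents in front; those before \<open>y^k\<close> must
  be brought next to a following letter, where \<open>fs_flip\<close> disposes of them.\<close>

lemma fs_y_comm: "set L \<subseteq> {1..n} \<Longrightarrow> \<exists>L'. set L' \<subseteq> {1..n} \<and> fs L * y ^ k = y ^ k * fs L'"
proof (induction L)
  case Nil
  show ?case by (rule exI[of _ "[]"]) simp
next
  case (Cons a L)
  then obtain L' where L': "set L' \<subseteq> {1..n}" "fs L * y ^ k = y ^ k * fs L'" by auto
  show ?case
  proof (cases "a \<le> k")
    case True
    then have "fs (a # L) * y ^ k = y ^ k * fs L'"
      using L' f_yk[of a k] Cons.prems by (simp add: mult.assoc) (simp add: mult.assoc[symmetric])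
    then show ?thesis using L' by blast
  next
    case False
    then have "fs (a # L) * y ^ k = y ^ k * fs ((a - k) # L')"
      using L' f_yk[of a k] Cons.prems by (simp add: mult.assoc) (simp add: mult.assoc[symmetric])
    moreover have "set ((a - k) # L') \<subseteq> {1..n}" using L' False Cons.prems by auto
    ultimately show ?thesis by blast
  qed
qed

lemma normal_elem_flip:
  assumes v: "normal_elem v" and z: "flip_letter n m z p q"
  shows "normal_elem (v * g z)"
proof -
  obtain w1 where w1: "trans_word w1" "f 1 * g z = word_prod g w1" using flip_f1[OF z] by blast
  \<comment> \<open>The image of \<open>x\<close> omits 1, so \<open>f 1\<close> fits before the
    letter and \<open>w1\<close> replaces both.\<close>
  have xz: "x ^ Suc d * g z = word_prod g (pow X (Suc d) @ w1)" for d
  proof -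
    have "x ^ Suc d * g z = x ^ d * (x * f 1) * g z" by (simp only: x_f1 power_Suc2)
    also have "\<dots> = x ^ Suc d * (f 1 * g z)" by (simp only: power_Suc2 mult.assoc)
    finally show ?thesis by (simp only: w1(2) word_prod_simps g_letters)
  qed
  have w1': "trans_word (pow X (Suc d) @ w1)" for d using w1 by (simp del: replicate.simps)
  \<comment> \<open>If \<open>k + p > n\<close>, the image of \<open>y^k\<close> omits
    \<open>p\<close>, and inserting \<open>f p\<close> turns the letter into
    \<open>e1\<close>.\<close>
  have yz: "normal_elem (y ^ k * g z)" for k
  proof (cases "k + p \<le> n")
    case True
    moreover have "0 + q \<le> n" using flip_bounds[OF z] by auto
    moreover have "y ^ k * g z = y ^ k * g z * x ^ 0" by simp
    ultimately show ?thesis using z unfolding normal_elem_def by blast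
  next
    case False
    have "y ^ k * g z = y ^ k * (f p * g z)"
      using yk_f_id[of p k] False flip_bounds[OF z] by (simp add: mult.assoc[symmetric])
    also have "\<dots> = y ^ k * e1" using f_flip[OF z, of p] flip_bounds[OF z] by simp
    finally show ?thesis
      by (intro normal_elem_word[OF trans_elem_yk[of k] e1_word]) (simp add: e1_def mult.assoc)
  qed
  show ?thesis
    using v unfolding normal_elem_def[of v] trans_elem_def
  proof (elim disjE exE conjE)
    fix L k assume L: "set L \<subseteq> {1..n}" and v: "v = fs L * x ^ k"
    show ?thesis
    proof (cases k)
      case 0
      from fs_flip[OF z L] show ?thesis
      proof
        assume "fs L * g z = g z"
        then show ?thesis using v 0 yz[of 0] by simp
      next
        assume "\<exists>w. trans_word w \<and> fs L * g z = word_prod g w"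
        then show ?thesis using v 0 normal_elem_word[OF trans_elem_1] by auto
      qed
    next
      case (Suc d)
      then show ?thesis using v xz[of d] w1'[of d] L
        by (intro normal_elem_word[OF trans_elem_fs_x[OF L, of 0], of "pow X (Suc d) @ w1"])
          (simp_all only: mult.assoc power_0 mult_1_right)
    qed
  next
    fix L k assume L: "set L \<subseteq> {1..n}" and v: "v = fs L * y ^ k"
    obtain L' where L': "set L' \<subseteq> {1..n}" "fs L * y ^ k = y ^ k * fs L'" using fs_y_comm[OF L] by blast
    then have v': "v * g z = y ^ k * (fs L' * g z)" using v by (simp add: mult.assoc)
    from fs_flip[OF z L'(1)] show ?thesis
    proof
      assume "fs L' * g z = g z"
      then show ?thesis using v' yz[of k] by simp
    next
      assume "\<exists>w. trans_word w \<and> fs L' * g z = word_prod g w"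
      then show ?thesis using v' normal_elem_word[OF trans_elem_yk] by auto
    qed
  next
    fix a c z0 p0 q0
    assume z0: "flip_letter n m z0 p0 q0" and ac: "a + p0 \<le> n" "c + q0 \<le> n"
      and v: "v = y ^ a * g z0 * x ^ c"
    have q0: "2 \<le> q0" "q0 \<le> n" using flip_bounds[OF z0] by auto
    have v0: "normal_elem (y ^ a * g z0)"
    proof -
      have "y ^ a * g z0 = y ^ a * g z0 * x ^ 0" "0 + q0 \<le> n" using q0 by simp_all
      then show ?thesis unfolding normal_elem_def using z0 ac(1) by blast
    qed
    show ?thesis
    proof (cases c)
      case (Suc d)
      then have "v * g z = (y ^ a * g z0) * word_prod g (pow X (Suc d) @ w1)"
        using v xz[of d] by (simp only: mult.assoc)
      then show ?thesis using normal_elem_trans_word[OF v0 w1'] by simp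
    next
      case 0
      show ?thesis
      proof (cases "q0 = p")
        case True
        then obtain w where w: "trans_word w" "g z0 * g z = word_prod g w"
          using flip_flip_inverse z0 z by metis
        then show ?thesis using v 0
          by (intro normal_elem_word[OF trans_elem_yk[of a] w(1)]) (simp add: mult.assoc)
      next
        case False
        have p: "2 \<le> p" "p \<le> n" using flip_bounds[OF z] by auto
        \<comment> \<open>The image of \<open>z0\<close> is \<open>{1, q0}\<close> and omits
          \<open>p\<close>, so \<open>f p\<close> fits between the two letters and turns the second
          into \<open>e1\<close>.\<close>
        have "g z0 = g z0 * f p" using flip_f[OF z0 p] False by simp
        moreover have "f p * g z = e1" using f_flip[OF z p] by simp
        ultimately have "v * g z = (y ^ a * g z0) * e1" using v 0 by (metis mult.assoc mult_1_right power_0)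
        then show ?thesis using normal_elem_trans_word[OF v0 e1_word] by (simp add: e1_def)
      qed
    qed
  qed
qed

lemma normal_elem_op_word:
  assumes "normal_elem v" "op_word w" shows "normal_elem (v * word_prod g w)"
  using assms
proof (induction w arbitrary: v)
  case (Cons l w)
  have "l \<in> {X, Y} \<or> (\<exists>i. l = E i \<and> 2 \<le> i \<and> i < n) \<or> (\<exists>p q. flip_letter n m l p q)"
    using Cons.prems(2) n by (auto simp: op_word_def alphabet_def flip_letter_def)
  then have "normal_elem (v * g l)"
    using Cons.prems normal_elem_x[of v] normal_elem_y[of v] normal_elem_f[of v] f_cases(3)[symmetric]
      normal_elem_flip[of v l] by auto
  then show ?case using Cons by (auto simp: op_word_def mult.assoc[symmetric])
qed auto

lemma op_word_normal: "op_word w \<Longrightarrow> normal_elem (word_prod g w)"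
  using normal_elem_op_word[of 1 w] trans_elem_1 by (simp add: normal_elem_def)

section \<open>Recovery of the normal form from the partial map\<close>

definition shift :: "int \<Rightarrow> 'a" where
  "shift k = (if k \<ge> 0 then x ^ nat k else y ^ nat (- k))"

definition undef_points :: "letter list \<Rightarrow> nat list" where
  "undef_points u = filter (\<lambda>i. act n u i = None) [1..<Suc n]"

lemma fs_xk: "set L \<subseteq> {1..n} \<Longrightarrow> \<forall>i\<in>set L. n < i + k \<Longrightarrow> fs L * x ^ k = x ^ k"
  by (induction L) (auto simp: mult.assoc f_xk)

lemma fs_yk: "set L \<subseteq> {1..n} \<Longrightarrow> \<forall>i\<in>set L. i \<le> k \<Longrightarrow> fs L * y ^ k = y ^ k"
  by (induction L) (auto simp: mult.assoc f_yk)

text \<open>The list \<open>L\<close> of a translation is not unique: points at which the power is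
  undefined may be listed or not. Adding all of them (\<open>?M\<close>) makes the index set the
  complement of the domain, which depends on the action alone.\<close>

lemma trans_normal_form:
  assumes u: "op_word u" "trans_elem (word_prod g u)"
  obtains k where "\<And>i j. act n u i = Some j \<Longrightarrow> int j = int i + k"
    and "word_prod g u = fs (undef_points u) * shift k"
proof -
  obtain L k where L: "set L \<subseteq> {1..n}"
    and uL: "word_prod g u = fs L * x ^ k \<or> word_prod g u = fs L * y ^ k"
    using u(2) by (auto simp: trans_elem_def)
  have set_undef: "set (undef_points u) = {i \<in> {1..n}. act n u i = None}"
    by (auto simp: undef_points_def)
  have dom_u: "i \<in> {1..n}" if "act n u i = Some j" for i j
    using act_bounds[OF op_wordD[OF u(1)] m_bounds(1) that] by simp
  from uL show ?thesis
  proof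
    assume *: "word_prod g u = fs L * x ^ k"
    then have "act n u = act n (restr_word n L @ pow X k)"
      using u(1) L op_word_restr by (intro sound op_wordD) (simp_all add: fs_def)
    then have act_u: "act n u i = (if i \<in> set L \<or> n < i + k then None else Some (i + k))"
      if "i \<in> {1..n}" for i
      using that L act_restr_word[OF L that] by (simp add: act_words)
    let ?M = "filter (\<lambda>i. n < i + k) [1..<Suc n]"
    have "word_prod g u = fs L * (fs ?M * x ^ k)" using * by (subst fs_xk) auto
    also have "\<dots> = fs (L @ ?M) * x ^ k" by (simp only: fs_simps mult.assoc)
    also have "fs (L @ ?M) = fs (undef_points u)"
      using L act_u by (intro fs_cong) (auto simp: set_undef split: if_splits)
    finally have "word_prod g u = fs (undef_points u) * shift (int k)" by (simp add: shift_def)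
    moreover have "int j = int i + int k" if "act n u i = Some j" for i j
      using act_u[OF dom_u[OF that]] that by (simp split: if_splits)
    ultimately show ?thesis using that[of "int k"] by simp
  next
    assume *: "word_prod g u = fs L * y ^ k"
    then have "act n u = act n (restr_word n L @ pow Y k)"
      using u(1) L op_word_restr by (intro sound op_wordD) (simp_all add: fs_def)
    then have act_u: "act n u i = (if i \<in> set L \<or> i \<le> k then None else Some (i - k))"
      if "i \<in> {1..n}" for i
      using that L act_restr_word[OF L that] by (simp add: act_words) linarith
    let ?M = "filter (\<lambda>i. i \<le> k) [1..<Suc n]"
    have "word_prod g u = fs L * (fs ?M * y ^ k)" using * by (subst fs_yk) auto
    also have "\<dots> = fs (L @ ?M) * y ^ k" by (simp only: fs_simps mult.assoc)
    also have "fs (L @ ?M) = fs (undef_points u)"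
      using L act_u by (intro fs_cong) (auto simp: set_undef split: if_splits)
    finally have "word_prod g u = fs (undef_points u) * shift (- int k)" by (cases "k = 0") (simp_all add: shift_def)
    moreover have "int j = int i + (- int k)" if "act n u i = Some j" for i j
      using act_u[OF dom_u[OF that]] that by (simp split: if_splits)
    ultimately show ?thesis using that[of "- int k"] by simp
  qed
qed

lemma flip_normal_form:
  assumes u: "op_word u" "word_prod g u = y ^ a * g z * x ^ c"
    and z: "flip_letter n m z p q" and ac: "a + p \<le> n" "c + q \<le> n"
  shows "act n u i =
    (if i = a + 1 then Some (c + 1) else if i = a + p then Some (c + q) else None)"
proof -
  have pq: "2 \<le> p" "p \<le> n" "2 \<le> q" "q \<le> n" using flip_bounds[OF z] by auto
  have *: "act n u = act n (pow Y a @ [z] @ pow X c)"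
    using u flip_in_alphabet[OF z] by (intro sound op_wordD) (simp_all add: mult.assoc)
  then show ?thesis using act_flip_word[OF z ac] by simp
qed

lemma op_word_cases:
  assumes u: "op_word u"
  obtains (trans) k where "\<And>i j. act n u i = Some j \<Longrightarrow> int j = int i + k"
    "word_prod g u = fs (undef_points u) * shift k"
  | (flip) a c z p q where "flip_letter n m z p q" "a + p \<le> n" "c + q \<le> n"
    "word_prod g u = y ^ a * g z * x ^ c"
    "\<And>i. act n u i = (if i = a + 1 then Some (c + 1) else if i = a + p then Some (c + q) else None)"
proof -
  from op_word_normal[OF u] show ?thesis
    unfolding normal_elem_def
  proof (elim disjE exE conjE)
    assume "trans_elem (word_prod g u)"
    from trans_normal_form[OF u this] show ?thesis using trans by blast
  next
    fix a c z p q
    assume "flip_letter n m z p q" "a + p \<le> n" "c + q \<le> n" "word_prod g u = y ^ a * g z * x ^ c"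
    then show ?thesis using flip[of z p q a c] flip_normal_form[OF u] by blast
  qed
qed

lemma op_word_mono:
  assumes u: "op_word u" and i: "act n u i = Some i'" and j: "act n u j = Some j'" and "i < j"
  shows "i' < j'"
  using u
proof (cases rule: op_word_cases)
  case (trans k)
  then show ?thesis using trans(1)[OF i] trans(1)[OF j] \<open>i < j\<close> by simp
next
  case (flip a c z p q)
  then show ?thesis using i j \<open>i < j\<close> flip_bounds[OF flip(1)] by (auto split: if_splits)
qed

text \<open>The two points of the domain are \<open>p - 1\<close> apart and their images
  \<open>q - 1\<close>; since \<open>p \<noteq> q\<close>, no single shift fits both.\<close>

lemma trans_flip_distinct:
  assumes "\<And>i j. act n u i = Some j \<Longrightarrow> int j = int i + k"
    and "flip_letter n m z p q"
    and "\<And>i. act n u i = (if i = a + 1 then Some (c + 1) else if i = a + p then Some (c + q) else None)"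
  shows False
proof -
  have pq: "2 \<le> p" "p \<noteq> q" using flip_bounds[OF assms(2)] by auto
  have "act n u (a + 1) = Some (c + 1)" "act n u (a + p) = Some (c + q)"
    using assms(3) pq by auto
  then show False using assms(1)[of "a + 1"] assms(1)[of "a + p"] pq by fastforce
qed

lemma zero_shift: "zero * shift k = zero"
  by (simp add: shift_def zero_x zero_y)

lemma op_complete:
  assumes u: "op_word u" and v: "op_word v" and uv: "act n u = act n v"
  shows "word_prod g u = word_prod g v"
  using u
proof (cases rule: op_word_cases)
  case u: (trans k)
  from v show ?thesis
  proof (cases rule: op_word_cases)
    case v: (trans l)
    have undef: "undef_points u = undef_points v" by (simp add: undef_points_def uv)
    show ?thesis
    proof (cases "\<exists>i j. act n u i = Some j")
      case True
      then obtain i j where "act n u i = Some j" by blast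
      then have "k = l" using u(1)[of i j] v(1)[of i j] uv by simp
      then show ?thesis using u v undef by simp
    next
      case False
      then have "act n u i = None" for i by (cases "act n u i") auto
      \<comment> \<open>The empty map determines no shift, so \<open>k\<close> and \<open>l\<close>
        may differ; \<open>zero\<close> absorbs both.\<close>
      then have "undef_points u = [1..<Suc n]" by (simp add: undef_points_def)
      then show ?thesis using u v undef zero_shift by (simp add: zero_def)
    qed
  next
    case (flip a c z p q)
    then show ?thesis using trans_flip_distinct[of u k z p q a c] u uv by simp
  qed
next
  case u: (flip a c z p q)
  note up = flip_bounds[OF u(1)]
  from v show ?thesis
  proof (cases rule: op_word_cases)
    case (trans k)
    then show ?thesis using trans_flip_distinct[of v k z p q a c] u uv by simp
  next
    case v: (flip a' c' z' p' q')
    note vp = flip_bounds[OF v(1)]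
    have eq: "act n u i = act n v i" for i using uv by simp
    \<comment> \<open>The domain consists of \<open>a + 1 < a + p\<close>, which fixes
      \<open>a\<close> and \<open>p\<close>. The image of \<open>a + 1\<close> then fixes
      \<open>c\<close>, and \<open>p\<close> fixes the letter.\<close>
    have "a + 1 = a' + 1 \<or> a + 1 = a' + p'" "a + p = a' + 1 \<or> a + p = a' + p'"
      "a' + 1 = a + 1 \<or> a' + 1 = a + p" "a' + p' = a + 1 \<or> a' + p' = a + p"
      using eq[of "a + 1"] eq[of "a + p"] eq[of "a' + 1"] eq[of "a' + p'"] up vp
      unfolding u(5) v(5) by (auto split: if_splits)
    moreover have "2 \<le> p" "2 \<le> p'" using up vp by auto
    ultimately have ap: "a = a'" "p = p'" by arith+
    then have "c = c'" using eq[of "a + 1"] unfolding u(5) v(5) by simp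
    moreover have "z = z'" using flip_target_unique u(1) v(1) ap by blast
    ultimately show ?thesis using u(4) v(4) ap by simp
  qed
qed

section \<open>The letter h\<close>

lemma h_square: "h * h = 1"
  using rel[of "[H, H]" "[]"] by (simp add: relations_def Vbar0_def chain_def)

lemma hx: "h * x = y * h"
  using rel[of "[H, X]" "[Y, H]"] by (simp add: relations_def Vbar1_def chain_def)

lemma h_left: "h * (h * a) = a"
  by (simp add: h_square mult.assoc[symmetric])

lemma hy: "h * y = x * h"
proof -
  have "h * y = h * (y * h) * h" by (simp add: mult.assoc h_square)
  also have "\<dots> = x * h" unfolding hx[symmetric] by (simp add: h_left)
  finally show ?thesis .
qed

text \<open>The relations give this only for \<open>i \<le> (n + 1) div 2\<close>; multiplying such
  an instance by \<open>h\<close> on both sides yields the other half.\<close>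

lemma he: assumes "2 \<le> i" "i < n" shows "h * e i = e (n + 1 - i) * h"
proof -
  have *: "h * e j = e (n - j + 1) * h" if "2 \<le> j" "j \<le> (n + 1) div 2" for j
    using that chain_rel[of "[[H, E j], [E (n - j + 1), H]]" "[H, E j]" "[E (n - j + 1), H]"]
    by (force simp: relations_def Vbar1_def)
  show ?thesis
  proof (cases "i \<le> (n + 1) div 2")
    case True
    then show ?thesis using *[of i] assms by (simp add: Suc_diff_le)
  next
    case False
    then have "2 \<le> n + 1 - i" "n + 1 - i \<le> (n + 1) div 2" "n - (n + 1 - i) + 1 = i"
      using assms by auto
    then have "h * e (n + 1 - i) = e i * h" using *[of "n + 1 - i"] by simp
    then have "h * (h * e (n + 1 - i)) * h = h * (e i * h) * h" by simp
    then show ?thesis by (simp add: h_left mult.assoc h_square)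
  qed
qed

lemma h_letter:
  assumes "l \<in> alphabet n m - {H}"
  obtains w where "op_word w" "h * g l = word_prod g w * h"
proof -
  consider "l = X" | "l = Y" | i where "l = E i" "2 \<le> i" "i < n"
    | i where "l = Xi i" "1 \<le> i" "i \<le> m" | i where "l = Yi i" "1 \<le> i" "i \<le> m"
    using assms n by (auto simp: alphabet_def)
  then show ?thesis
  proof cases
    case 1
    then show ?thesis using that[of "[Y]"] hx by (simp add: alphabet_def)
  next
    case 2
    then show ?thesis using that[of "[X]"] hy by (simp add: alphabet_def)
  next
    case (3 i)
    then show ?thesis using that[of "[E (n + 1 - i)]"] he[of i]
      by (simp add: alphabet_def image_iff) linarith
  next
    case (4 i)
    let ?w = "pow Y (n - i - 1) @ [Xi i] @ pow X (i - 1)"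
    have "word_prod g [H, Xi i] = word_prod g (pow Y (n - i - 1) @ [Xi i] @ pow X (i - 1) @ [H])"
      using 4 by (intro chain_rel[where ws = "[[H, Xi i], pow Y (n - i - 1) @ [Xi i] @ pow X (i - 1) @ [H]]"])
        (force simp: relations_def Vbar1_def)+
    then show ?thesis using 4 that[of ?w] by (auto simp: alphabet_def mult.assoc)
  next
    case (5 i)
    let ?w = "pow Y (i - 1) @ [Yi i] @ pow X (n - i - 1)"
    have "word_prod g [H, Yi i] = word_prod g (pow Y (i - 1) @ [Yi i] @ pow X (n - i - 1) @ [H])"
      using 5 by (intro chain_rel[where ws = "[[H, Yi i], pow Y (i - 1) @ [Yi i] @ pow X (n - i - 1) @ [H]]"])
        (force simp: relations_def Vbar1_def)+
    then show ?thesis using 5 that[of ?w] by (auto simp: alphabet_def mult.assoc)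
  qed
qed

lemma h_op_word: "op_word w \<Longrightarrow> \<exists>w'. op_word w' \<and> h * word_prod g w = word_prod g w' * h"
proof (induction w)
  case Nil
  show ?case by (rule exI[of _ "[]"]) simp
next
  case (Cons l w)
  then obtain w1 where w1: "op_word w1" "h * word_prod g w = word_prod g w1 * h" by auto
  obtain w2 where w2: "op_word w2" "h * g l = word_prod g w2 * h"
    using h_letter[of l] Cons.prems by auto
  have "h * word_prod g (l # w) = word_prod g w2 * (h * word_prod g w)"
    by (simp add: mult.assoc[symmetric] w2)
  also have "\<dots> = word_prod g (w2 @ w1) * h" by (simp add: w1 mult.assoc)
  finally show ?case using w1 w2 by (intro exI[of _ "w2 @ w1"]) simp
qed

lemma split_h:
  "w \<in> lists (alphabet n m) \<Longrightarrow>
    \<exists>u. op_word u \<and> (word_prod g w = word_prod g u \<or> word_prod g w = word_prod g (u @ [H]))"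
proof (induction w)
  case Nil
  show ?case by (rule exI[of _ "[]"]) simp
next
  case (Cons l w)
  then obtain u where u: "op_word u"
    "word_prod g w = word_prod g u \<or> word_prod g w = word_prod g (u @ [H])" by auto
  show ?case
  proof (cases "l = H")
    case False
    then show ?thesis using Cons.prems u by (intro exI[of _ "l # u"]) (auto simp: mult.assoc)
  next
    case True
    obtain u' where u': "op_word u'" "h * word_prod g u = word_prod g u' * h"
      using h_op_word[OF u(1)] by blast
    have "word_prod g (l # w) = word_prod g (u' @ [H]) \<or> word_prod g (l # w) = word_prod g u'"
      using u(2)
    proof
      assume "word_prod g w = word_prod g u"
      then show ?thesis using True u' by simp
    next
      assume "word_prod g w = word_prod g (u @ [H])"
      then have "word_prod g (l # w) = h * word_prod g u * h" using True by (simp add: mult.assoc)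
      then show ?thesis using u' by (simp add: mult.assoc h_square)
    qed
    then show ?thesis using u' by blast
  qed
qed

lemma e1_h: "e1 * h = x ^ (n - 1)"
proof -
  have "word_prod g (es 2 (n - 1) @ [X, Y, H]) = word_prod g (pow X (n - 1))"
    by (rule chain_rel[where ws = "[es 2 (n - 1) @ [X, Y, H], pow X (n - 1)]"])
      (auto simp: relations_def Vbar2_def)
  then show ?thesis by (simp add: e1_def mult.assoc)
qed

lemma xk_h: "x ^ k * h = h * y ^ k"
proof (induction k)
  case (Suc k)
  then show ?case by (simp add: mult.assoc) (simp add: mult.assoc[symmetric] hy)
qed simp

text \<open>
  As \<open>u\<close> and \<open>v\<close> are order-preserving, \<open>u\<close> has rank at most 1, and then \<open>u h\<close> equals a word without \<open>h\<close>.
\<close>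

lemma mixed_complete:
  assumes u: "op_word u" and v: "op_word v" and uv: "act n (u @ [H]) = act n v"
  shows "word_prod g (u @ [H]) = word_prod g v"
proof -
  have H: "H \<in> alphabet n m" by (simp add: alphabet_def)
  \<comment> \<open>It suffices to rewrite \<open>u h\<close> without \<open>h\<close>;
    \<open>op_complete\<close> then compares the result with \<open>v\<close>.\<close>
  have finish: ?thesis if "op_word t" "word_prod g (u @ [H]) = word_prod g t" for t
  proof -
    have "act n (u @ [H]) = act n t"
      using that u H op_wordD by (intro sound) auto
    then show ?thesis using op_complete[OF that(1) v] that(2) uv by simp
  qed
  have bounds: "i \<in> {1..n} \<and> j \<in> {1..n}" if "act n u i = Some j" for i j
    using act_bounds[OF op_wordD[OF u] m_bounds(1) that] .
  have not_less: "\<not> i < j" if "act n u i = Some i'" "act n u j = Some j'" for i j i' j'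
  proof
    assume "i < j"
    have "act n v i = Some (n + 1 - i')" "act n v j = Some (n + 1 - j')"
      using uv[symmetric] that act_append_H[OF op_wordD[OF u]] by simp_all
    from op_word_mono[OF v this \<open>i < j\<close>] op_word_mono[OF u that \<open>i < j\<close>] bounds[OF that(2)]
    show False by auto
  qed
  show ?thesis
  proof (cases "\<exists>i j. act n u i = Some j")
    case False
    then have empty: "act n u i = None" for i by (cases "act n u i") auto
    let ?t = "restr_word n [1..<Suc n]"
    have t: "op_word ?t" by (rule op_word_restr) auto
    have "act n u = act n ?t"
    proof (rule act_eqI[OF op_wordD[OF u] op_wordD[OF t] m_bounds(1)])
      fix i assume "1 \<le> i" "i \<le> n"
      moreover have "set [1..<Suc n] \<subseteq> {1..n}" by auto
      ultimately show "act n u i = act n ?t i"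
        using act_restr_word[of "[1..<Suc n]" i "[]"] empty by (simp del: upt_Suc)
    qed
    then have "word_prod g u = zero"
      using op_complete[OF u t] by (simp add: zero_def fs_def)
    \<comment> \<open>The factors of \<open>e1\<close> already occur in \<open>zero\<close>;
      displaying \<open>e1\<close> lets \<open>e1 * h = x^(n - 1)\<close> consume
      \<open>h\<close>.\<close>
    also have "zero = zero * e1" unfolding zero_def e1_eq by (rule fs_absorb[symmetric]) auto
    finally have "word_prod g (u @ [H]) = zero * (e1 * h)" by (simp add: mult.assoc)
    also have "\<dots> = word_prod g ?t" by (simp add: e1_h zero_x) (simp add: zero_def fs_def)
    finally show ?thesis using finish[OF t] by simp
  next
    case True
    then obtain i j where ij: "act n u i = Some j" by blast
    have single: "act n u k = (if k = i then Some j else None)" for k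
    proof (cases "act n u k")
      case (Some k')
      then have "k = i" using not_less[OF ij Some] not_less[OF Some ij] by simp
      then show ?thesis using ij by simp
    qed (use ij in auto)
    have b: "1 \<le> i" "i \<le> n" "1 \<le> j" "j \<le> n" using bounds[OF ij] by auto
    \<comment> \<open>The map \<open>i \<mapsto> j\<close> is factored through 1 to expose
      \<open>e1\<close>; exchanging \<open>h\<close> with \<open>x^(j - 1)\<close> later brings it
      next to \<open>e1\<close>.\<close>
    let ?t = "pow Y (i - 1) @ es 2 (n - 1) @ [X, Y] @ pow X (j - 1)"
    have t: "op_word ?t" using n by (intro trans_op_word) auto
    have "act n u = act n ?t"
    proof (rule act_eqI[OF op_wordD[OF u] op_wordD[OF t] m_bounds(1)])
      fix k assume k: "1 \<le> k" "k \<le> n"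
      have "act n ?t k = (if i - 1 < k then act n (es 2 (n - 1) @ X # Y # pow X (j - 1)) (k - (i - 1)) else None)"
        using k by (simp add: act_Y)
      also have "\<dots> = (if k = i then Some j else None)"
      proof (cases "i - 1 < k")
        case True
        then have k': "1 \<le> k - (i - 1)" "k - (i - 1) \<le> n" using k by auto
        show ?thesis
        proof (cases "k = i")
          case True
          then have [simp]: "k - (i - 1) = 1" using b by simp
          show ?thesis using True n b by (simp add: act_words)
        next
          case False
          then have "2 \<le> k - (i - 1)" using True b by simp
          then show ?thesis using k' False True unfolding act_es[OF k'] by (simp add: act_words) linarith
        qed
      qed (use b in auto)
      finally show "act n u k = act n ?t k" using single by simp
    qed
    then have "word_prod g u = y ^ (i - 1) * e1 * x ^ (j - 1)"
      using op_complete[OF u t] by (simp add: e1_def mult.assoc)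
    then have "word_prod g (u @ [H]) = y ^ (i - 1) * (e1 * h) * y ^ (j - 1)"
      by (simp add: mult.assoc xk_h)
    also have "\<dots> = word_prod g (pow Y (i - 1) @ pow X (n - 1) @ pow Y (j - 1))"
      by (simp add: e1_h mult.assoc)
    finally show ?thesis using finish[of "pow Y (i - 1) @ pow X (n - 1) @ pow Y (j - 1)"] by simp
  qed
qed

lemma complete:
  assumes u: "u \<in> lists (alphabet n m)" and v: "v \<in> lists (alphabet n m)" and uv: "act n u = act n v"
  shows "word_prod g u = word_prod g v"
proof -
  have H: "H \<in> alphabet n m" by (simp add: alphabet_def)
  obtain u' where u': "op_word u'"
    "word_prod g u = word_prod g u' \<or> word_prod g u = word_prod g (u' @ [H])"
    using split_h[OF u] by blast
  obtain v' where v': "op_word v'"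
    "word_prod g v = word_prod g v' \<or> word_prod g v = word_prod g (v' @ [H])"
    using split_h[OF v] by blast
  have in_lists: "u' \<in> lists (alphabet n m)" "u' @ [H] \<in> lists (alphabet n m)"
      "v' \<in> lists (alphabet n m)" "v' @ [H] \<in> lists (alphabet n m)"
    using op_wordD[OF u'(1)] op_wordD[OF v'(1)] H by auto
  note act_u = sound[OF u in_lists(1)] sound[OF u in_lists(2)]
    and act_v = sound[OF v in_lists(3)] sound[OF v in_lists(4)]
  from u'(2) v'(2) show ?thesis
  proof (elim disjE)
    assume *: "word_prod g u = word_prod g u'" "word_prod g v = word_prod g v'"
    have "act n u' = act n v'" using act_u(1)[OF *(1)] act_v(1)[OF *(2)] uv by metis
    then show ?thesis using op_complete[OF u'(1) v'(1)] * by metis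
  next
    assume *: "word_prod g u = word_prod g u'" "word_prod g v = word_prod g (v' @ [H])"
    have "act n (v' @ [H]) = act n u'" using act_u(1)[OF *(1)] act_v(2)[OF *(2)] uv by metis
    then show ?thesis using mixed_complete[OF v'(1) u'(1)] * by metis
  next
    assume *: "word_prod g u = word_prod g (u' @ [H])" "word_prod g v = word_prod g v'"
    have "act n (u' @ [H]) = act n v'" using act_u(2)[OF *(1)] act_v(1)[OF *(2)] uv by metis
    then show ?thesis using mixed_complete[OF u'(1) v'(1)] * by metis
  next
    assume *: "word_prod g u = word_prod g (u' @ [H])" "word_prod g v = word_prod g (v' @ [H])"
    \<comment> \<open>\<open>h\<close> is an involution on \<open>{1..n}\<close>, so it cancels on
      the level of maps and the two prefixes act alike.\<close>
    have flip: "act n w i = map_option (\<lambda>j. n + 1 - j) (act n (w @ [H]) i)" if "w \<in> lists (alphabet n m)" for w i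
      unfolding act_append_H[OF that] using act_bounds[OF that m_bounds(1), of i]
      by (cases "act n w i") auto
    have "act n (u' @ [H]) = act n (v' @ [H])" using act_u(2)[OF *(1)] act_v(2)[OF *(2)] uv by metis
    then have "act n u' = act n v'" using flip[OF in_lists(1)] flip[OF in_lists(3)] by auto
    then show ?thesis using * op_complete[OF u'(1) v'(1)] by simp
  qed
qed

end

section \<open>The number of letters and relations\<close>

lemma finite_chain [simp]: "finite (chain ws)"
  by (metis List.finite_set chain_def)

declare chain_def [simp]

lemma finite_relations: "finite (relations n m)"
  unfolding relations_def V1_def V2_def V3_def V4_def V5_def V6_def V7_def V8_def V9_def V10_def V11_def
    V12_def V13_def V14_def Vbar0_def Vbar1_def Vbar2_def
  by (simp del: chain_def)

lemma card_UN_const: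
  assumes "finite I" "\<And>i. i \<in> I \<Longrightarrow> card (A i) = c"
    and "\<And>i j. i \<in> I \<Longrightarrow> j \<in> I \<Longrightarrow> i \<noteq> j \<Longrightarrow> A i \<inter> A j = {}" and "\<And>i. i \<in> I \<Longrightarrow> finite (A i)"
  shows "card (\<Union>i\<in>I. A i) = card I * c"
  using assms by (subst card_UN_disjoint) auto

lemma card_Un_disj:
  "finite A \<Longrightarrow> finite B \<Longrightarrow> A \<inter> B = {} \<Longrightarrow> card A = a \<Longrightarrow> card B = b \<Longrightarrow> card (A \<union> B) = a + b"
  by (simp add: card_Un_disjoint)

lemma card_V1: "card (V1 n) = n - 2"
  unfolding V1_def by (subst card_UN_const[where c = 1]) auto

lemma card_V2: "card V2 = 2" and card_V3: "card V3 = 1"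
  by (auto simp: V2_def V3_def)

text \<open>The factor 2 avoids a division in the triangular number.\<close>

lemma card_V4: assumes "n \<ge> 4" shows "2 * card (V4 n) = (n - 2) * (n - 3)"
proof -
  have "card (V4 n) = (\<Sum>i\<in>{2..n-1}. card (\<Union>j\<in>{i<..n - 1}. chain [[E i, E j], [E j, E i]]))"
    unfolding V4_def by (intro card_UN_disjoint) (auto simp: disjoint_iff)
  also have "\<dots> = (\<Sum>i\<in>{2..n-1}. n - 1 - i)"
    by (intro sum.cong refl, subst card_UN_const[where c = 1]) (auto simp: disjoint_iff)
  also have "\<dots> = (\<Sum>i<n - 2. i)"
    by (rule sum.reindex_bij_witness[of _ "\<lambda>i. n - 1 - i" "\<lambda>i. n - 1 - i"]) auto
  also have "2 * \<dots> = (n - 2) * (n - 3)"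
  proof -
    have "2 * (\<Sum>i<Suc k. i) = Suc k * k" for k :: nat by (induction k) auto
    moreover have "n - 2 = Suc (n - 3)" using assms by simp
    ultimately show ?thesis by metis
  qed
  finally show ?thesis .
qed

lemma card_V5: "card (V5 n) = 2 * (n - 2)"
  unfolding V5_def by (subst card_UN_const[where c = 2]) (auto simp: disjoint_iff)

lemma card_V6: "card (V6 n) = n - 3"
  unfolding V6_def by (subst card_UN_const[where c = 1]) (auto simp: disjoint_iff)

lemma card_V7: "card (V7 n) = 2" and card_V8: "card (V8 n) = 1"
  by (auto simp: V7_def V8_def)

lemma card_V9: assumes "1 \<le> m" shows "card (V9 n m) = 2 * m"
proof -
  have "card (V9 n m) = m + 1 + (m - 1)"
    unfolding V9_def
    by (intro card_Un_disj) (auto simp: disjoint_iff card_UN_const[where c = 1])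
  then show ?thesis using assms by simp
qed

lemma card_V10:
  assumes "n \<ge> 4" "2 * m < n" "1 \<le> m" shows "card (V10 n m) = 2 * (m * (n - 3) + 1)"
proof -
  have "card (V10 n m) = (\<Sum>i\<in>{1..m}. card (\<Union>j\<in>{2..n - 1} - {n - i + 1}.
     chain [[Xi i, E j], [Xi i]] \<union> chain [[E j, Yi i], [Yi i]]))"
    unfolding V10_def by (intro card_UN_disjoint) (auto simp: disjoint_iff)
  also have "\<dots> = (\<Sum>i\<in>{1..m}. card ({2..n - 1} - {n - i + 1}) * 2)"
    by (intro sum.cong refl card_UN_const) (auto simp: disjoint_iff)
  \<comment> \<open>For \<open>i = 1\<close> the excluded index \<open>n - i + 1 = n\<close> lies
    outside \<open>{2..n - 1}\<close>, so one more \<open>j\<close> remains.\<close>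
  also have "\<dots> = (\<Sum>i\<in>{1..m}. if i = 1 then 2 * (n - 2) else 2 * (n - 3))"
    using assms by (intro sum.cong refl) (auto simp: card_Diff_singleton_if)
  also have "\<dots> = 2 * (n - 2) + (\<Sum>i\<in>{2..m}. 2 * (n - 3))"
    using assms(3) by (subst sum.atLeast_Suc_atMost) (auto simp: numeral_2_eq_2 intro!: sum.cong)
  also have "\<dots> = 2 * (m * (n - 3) + 1)"
  proof -
    obtain k l where "m = Suc k" "n = l + 4"
      using assms by (metis One_nat_def Suc_le_D add.commute le_Suc_ex)
    then show ?thesis by (simp add: algebra_simps)
  qed
  finally show ?thesis .
qed

lemma card_V11:
  assumes "n \<ge> 4" "2 * m < n" "1 \<le> m" shows "card (V11 n m) = 2 * (m * (n - 3))"
proof -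
  have "card (V11 n m) = (\<Sum>i\<in>{1..m}. card (\<Union>j\<in>{2..n - 1} - {i + 1}.
     chain [[E j, Xi i], [Xi i]] \<union> chain [[Yi i, E j], [Yi i]]))"
    unfolding V11_def by (intro card_UN_disjoint) (auto simp: disjoint_iff)
  also have "\<dots> = (\<Sum>i\<in>{1..m}. card ({2..n - 1} - {i + 1}) * 2)"
    by (intro sum.cong refl card_UN_const) (auto simp: disjoint_iff)
  \<comment> \<open>Unlike in (V10), the excluded index \<open>i + 1 \<le> m + 1 < n\<close> is
    always in the range.\<close>
  also have "\<dots> = (\<Sum>i\<in>{1..m}. 2 * (n - 3))"
    using assms by (intro sum.cong refl) (auto simp: card_Diff_singleton_if)
  finally show ?thesis by simp
qed

lemma card_V12: "1 \<le> m \<Longrightarrow> card (V12 m) = 4 * m - 2"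
proof -
  assume "1 \<le> m"
  have "card (V12 m) = (m - 1) * 4 + 1 + 1"
    unfolding V12_def
    by (intro card_Un_disj) (auto simp: disjoint_iff card_UN_const[where c = 4])
  then show ?thesis using \<open>1 \<le> m\<close> by simp
qed

lemma card_V13: "1 \<le> m \<Longrightarrow> card (V13 n m) = 4 * m"
proof -
  assume "1 \<le> m"
  have "card (V13 n m) = 2 + (m - 1) * 2 + m * 2"
    unfolding V13_def
    by (intro card_Un_disj) (auto simp: disjoint_iff card_UN_const[where c = 2])
  then show ?thesis using \<open>1 \<le> m\<close> by simp
qed

lemma card_V14: "1 \<le> m \<Longrightarrow> card (V14 n m) = 4 * m"
proof -
  assume "1 \<le> m"
  have "card (V14 n m) = 4 + (m - 1) * 4"
    unfolding V14_def
    by (intro card_Un_disj) (auto simp: disjoint_iff card_UN_const[where c = 4])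
  then show ?thesis using \<open>1 \<le> m\<close> by simp
qed

lemma card_Vbar0: "card Vbar0 = 1" and card_Vbar2: "card (Vbar2 n) = 1"
  by (auto simp: Vbar0_def Vbar2_def)

lemma card_Vbar1: "card (Vbar1 n m) = 1 + ((n + 1) div 2 - 1) + 2 * m"
proof -
  have "card (Vbar1 n m) = 1 + ((n + 1) div 2 - 1) + m * 2"
    unfolding Vbar1_def
    by (intro card_Un_disj) (auto simp: disjoint_iff card_UN_const[where c = 2] card_UN_const[where c = 1])
  then show ?thesis by simp
qed


lemma card_relations_sum:
  assumes "n \<ge> 4" "2 * m < n" "1 \<le> m"
  shows "card (relations n m) = card (V1 n) + card V2 + card V3 + card (V4 n) + card (V5 n) +
    card (V6 n) + card (V7 n) + card (V8 n) + card (V9 n m) + card (V10 n m) + card (V11 n m) +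
    card (V12 m) + card (V13 n m) + card (V14 n m) + card Vbar0 + card (Vbar1 n m) + card (Vbar2 n)"
proof -
  \<comment> \<open>\<open>n \<ge> 4\<close> guarantees that \<open>E 2\<close> and
    \<open>E 3\<close> both occur. Exposing them distinguishes words containing this product from
    the words of the other families.\<close>
  have es2: "es 2 (n - 1) = E 2 # E 3 # es 4 (n - 1)"
    using assms(1) by (simp add: es_def upt_conv_Cons numeral_eq_Suc)
  note fin = finite_relations[of n m, unfolded relations_def finite_Un]
  note defs = V1_def V2_def V3_def V4_def V5_def V6_def V7_def V8_def V9_def V10_def V11_def
    V12_def V13_def V14_def Vbar0_def Vbar1_def Vbar2_def
  show ?thesis
    unfolding relations_def
  proof (intro card_Un_disj refl finite_UnI; (simp only: fin)?)
    show "V1 n \<inter> V2 = {}"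
      "(V1 n \<union> V2) \<inter> V3 = {}"
      "(V1 n \<union> V2 \<union> V3) \<inter> V4 n = {}"
      "(V1 n \<union> V2 \<union> V3 \<union> V4 n) \<inter> V5 n = {}"
      "(V1 n \<union> V2 \<union> V3 \<union> V4 n \<union> V5 n) \<inter> V6 n = {}"
      "(V1 n \<union> V2 \<union> V3 \<union> V4 n \<union> V5 n \<union> V6 n) \<inter> V7 n = {}"
      by (auto simp: defs)
    show "(V1 n \<union> V2 \<union> V3 \<union> V4 n \<union> V5 n \<union> V6 n \<union> V7 n) \<inter> V8 n = {}"
      by (auto simp: defs es2)
    show "(V1 n \<union> V2 \<union> V3 \<union> V4 n \<union> V5 n \<union> V6 n \<union> V7 n \<union> V8 n) \<inter> V9 n m = {}"
      by (auto simp: defs)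
    show "(V1 n \<union> V2 \<union> V3 \<union> V4 n \<union> V5 n \<union> V6 n \<union> V7 n \<union> V8 n \<union> V9 n m) \<inter> V10 n m = {}"
      by (auto simp: defs)
    show "(V1 n \<union> V2 \<union> V3 \<union> V4 n \<union> V5 n \<union> V6 n \<union> V7 n \<union> V8 n \<union> V9 n m \<union> V10 n m) \<inter> V11 n m = {}"
      by (auto simp: defs)
    show "(V1 n \<union> V2 \<union> V3 \<union> V4 n \<union> V5 n \<union> V6 n \<union> V7 n \<union> V8 n \<union> V9 n m \<union> V10 n m \<union> V11 n m)
        \<inter> V12 m = {}"
      by (auto simp: defs)
    show "(V1 n \<union> V2 \<union> V3 \<union> V4 n \<union> V5 n \<union> V6 n \<union> V7 n \<union> V8 n \<union> V9 n m \<union> V10 n m \<union> V11 n m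
        \<union> V12 m) \<inter> V13 n m = {}"
      by (auto simp: defs es2)
    show "(V1 n \<union> V2 \<union> V3 \<union> V4 n \<union> V5 n \<union> V6 n \<union> V7 n \<union> V8 n \<union> V9 n m \<union> V10 n m \<union> V11 n m
        \<union> V12 m \<union> V13 n m) \<inter> V14 n m = {}"
      by (auto simp: defs)
    show "(V1 n \<union> V2 \<union> V3 \<union> V4 n \<union> V5 n \<union> V6 n \<union> V7 n \<union> V8 n \<union> V9 n m \<union> V10 n m \<union> V11 n m
        \<union> V12 m \<union> V13 n m \<union> V14 n m) \<inter> Vbar0 = {}"
      by (auto simp: defs)
    show "(V1 n \<union> V2 \<union> V3 \<union> V4 n \<union> V5 n \<union> V6 n \<union> V7 n \<union> V8 n \<union> V9 n m \<union> V10 n m \<union> V11 n m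
        \<union> V12 m \<union> V13 n m \<union> V14 n m \<union> Vbar0) \<inter> Vbar1 n m = {}"
      by (auto simp: defs)
    show "(V1 n \<union> V2 \<union> V3 \<union> V4 n \<union> V5 n \<union> V6 n \<union> V7 n \<union> V8 n \<union> V9 n m \<union> V10 n m \<union> V11 n m
        \<union> V12 m \<union> V13 n m \<union> V14 n m \<union> Vbar0 \<union> Vbar1 n m) \<inter> Vbar2 n = {}"
      by (auto simp: defs es2)
  qed
qed

declare chain_def [simp del]

lemma card_relations:
  assumes "n \<ge> 4" "m = (n - 1) div 2"
  shows "real (card (relations n m)) =
    1 / 2 * (5 * real n ^ 2 + (2 - 2 * (-1) ^ n) * real n - (3 + 5 * (-1) ^ n) / 2)"
proof -
  have m: "2 * m < n" "1 \<le> m" using assms by auto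
  note cards = card_V1 card_V2 card_V3 card_V5
    card_V6 card_V7 card_V8 card_V9[OF m(2)] card_V10[OF assms(1) m] card_V11[OF assms(1) m]
    card_V12[OF m(2)] card_V13[OF m(2)] card_V14[OF m(2)] card_Vbar0 card_Vbar1 card_Vbar2
  show ?thesis
  proof (cases "even n")
    case True
    \<comment> \<open>Parametrising \<open>n\<close> by parity removes the divisions and truncated
      subtractions and evaluates \<open>(-1)^n\<close>; the offsets 4 and 5 are the least values of
      \<open>n\<close>.\<close>
    then have "n = 2 * ((n - 4) div 2) + 4" using assms(1) by presburger
    then obtain k where k: "n = 2 * k + 4" by blast
    then have m': "m = k + 1" and half: "(n + 1) div 2 = k + 2" using assms by simp_all
    have "card (V4 n) = (k + 1) * (2 * k + 1)" using card_V4[OF assms(1)] k by simp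
    note V4 = this
    have "card (relations n m) = 10 * k ^ 2 + 40 * k + 38"
      by (simp only: card_relations_sum[OF assms(1) m] cards half V4)
        (simp add: k m' algebra_simps power2_eq_square)
    then have "real (card (relations n m)) = 10 * real k ^ 2 + 40 * real k + 38" by simp
    then show ?thesis using True k by (simp add: power2_eq_square field_simps)
  next
    case False
    then have "n = 2 * ((n - 5) div 2) + 5" using assms(1) by presburger
    then obtain k where k: "n = 2 * k + 5" by blast
    then have m': "m = k + 2" and half: "(n + 1) div 2 = k + 3" using assms by simp_all
    have "card (V4 n) = (k + 1) * (2 * k + 3)"
      using card_V4[OF assms(1)] k by (simp add: algebra_simps)
    note V4 = this
    have "card (relations n m) = 10 * k ^ 2 + 54 * k + 73"
      by (simp only: card_relations_sum[OF assms(1) m] cards half V4)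
        (simp add: k m' algebra_simps power2_eq_square)
    then have "real (card (relations n m)) = 10 * real k ^ 2 + 54 * real k + 73" by simp
    then show ?thesis using False k by (simp add: power2_eq_square field_simps)
  qed
qed

lemma card_alphabet:
  assumes "n \<ge> 4" "m = (n - 1) div 2"
  shows "real (card (alphabet n m)) = 2 * real n - (1 + (-1) ^ n) / 2"
proof -
  have "card (alphabet n m) = 3 + card {2..n - 1} + card {1..m} + card {1..m}"
    unfolding alphabet_def
    by (intro card_Un_disj card_image) (auto simp: inj_on_def)
  then have *: "card (alphabet n m) = n + 1 + 2 * m" using assms by simp
  show ?thesis
  proof (cases "even n")
    case True
    then have "n = 2 * m + 2" using assms by presburger
    then show ?thesis using * True by simp
  next
    case False
    then have "n = 2 * m + 1" using assms by presburger
    then show ?thesis using * False by simp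
  qed
qed

section \<open>Words for the elements of the monoid\<close>

text \<open>Cyclic distance without a minimum: \<open>d\<close> and \<open>n - d\<close> describe
  the same distance on a cycle. As \<open>n - (n - d) = d\<close>, the condition is symmetric and
  transitive, so it passes to inverses and composites.\<close>

definition dist_compat :: "nat \<Rightarrow> (nat \<Rightarrow> nat) \<Rightarrow> bool" where
  "dist_compat n p \<longleftrightarrow> (\<forall>i\<in>{1..n}. \<forall>j\<in>{1..n}.
     \<bar>int (p i) - int (p j)\<bar> \<in> {\<bar>int i - int j\<bar>, int n - \<bar>int i - int j\<bar>})"

lemma dist_compat_inv:
  assumes "p permutes {1..n}" "dist_compat n p" shows "dist_compat n (inv' p)"
  unfolding dist_compat_def
proof (intro ballI)
  fix i j assume "i \<in> {1..n}" "j \<in> {1..n}"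
  then have "inv' p i \<in> {1..n}" "inv' p j \<in> {1..n}"
    using permutes_in_image[OF permutes_inv[OF assms(1)]] by auto
  then have "\<bar>int (p (inv' p i)) - int (p (inv' p j))\<bar>
      \<in> {\<bar>int (inv' p i) - int (inv' p j)\<bar>, int n - \<bar>int (inv' p i) - int (inv' p j)\<bar>}"
    using assms(2) unfolding dist_compat_def by blast
  then show "\<bar>int (inv' p i) - int (inv' p j)\<bar> \<in> {\<bar>int i - int j\<bar>, int n - \<bar>int i - int j\<bar>}"
    using permutes_inverses(1)[OF assms(1)] by auto
qed

lemma dist_compat_comp:
  assumes "q permutes {1..n}" "dist_compat n p" "dist_compat n q" shows "dist_compat n (p \<circ> q)"
  unfolding dist_compat_def
proof (intro ballI)
  fix i j assume ij: "i \<in> {1..n}" "j \<in> {1..n}"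
  then have "q i \<in> {1..n}" "q j \<in> {1..n}"
    using permutes_in_image[OF assms(1)] by auto
  then have "\<bar>int (p (q i)) - int (p (q j))\<bar>
      \<in> {\<bar>int (q i) - int (q j)\<bar>, int n - \<bar>int (q i) - int (q j)\<bar>}"
    using assms(2) unfolding dist_compat_def by blast
  moreover have "\<bar>int (q i) - int (q j)\<bar> \<in> {\<bar>int i - int j\<bar>, int n - \<bar>int i - int j\<bar>}"
    using ij assms(3) unfolding dist_compat_def by blast
  ultimately show "\<bar>int ((p \<circ> q) i) - int ((p \<circ> q) j)\<bar>
      \<in> {\<bar>int i - int j\<bar>, int n - \<bar>int i - int j\<bar>}"
    by auto
qed

lemma refl_perm_permutes: "refl_perm n permutes {1..n}"
  by (rule bij_imp_permutes, rule bij_betw_byWitness[where f' = "refl_perm n"])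
    (auto simp: refl_perm_def)

lemma rot_perm_permutes: "n \<ge> 1 \<Longrightarrow> rot_perm n permutes {1..n}"
  by (rule bij_imp_permutes,
      rule bij_betw_byWitness[where f' = "\<lambda>i. if i = 1 then n else i - 1"])
    (auto simp: rot_perm_def)

lemma dist_compat_generators: "dist_compat n (refl_perm n)" "dist_compat n (rot_perm n)"
  unfolding dist_compat_def by (auto simp: refl_perm_def rot_perm_def)

lemma dihedral_permutes_dist:
  assumes "n \<ge> 1" "p \<in> dihedral_perms n" shows "p permutes {1..n} \<and> dist_compat n p"
  using assms(2) unfolding dihedral_perms_def
proof (induction rule: generate.induct)
  case one
  show ?case unfolding sym_group_one
    by (rule conjI[OF permutes_id]) (simp add: dist_compat_def)
next
  case (incl p)
  then show ?case
    using refl_perm_permutes rot_perm_permutes[OF assms(1)] dist_compat_generators by auto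
next
  case (inv p)
  then have p: "p permutes {1..n}" "dist_compat n p"
    using refl_perm_permutes rot_perm_permutes[OF assms(1)] dist_compat_generators by auto
  then have "inv\<^bsub>sym_group n\<^esub> p = inv' p" by (simp add: sym_group_carrier)
  then show ?case using permutes_inv[OF p(1)] dist_compat_inv[OF p] by simp
next
  case (eng p q)
  then show ?case unfolding sym_group_mult
    using permutes_compose[of q _ p] dist_compat_comp[of q n p] by blast
qed

lemma dihedral_perms_intros:
  "id \<in> dihedral_perms n" "rot_perm n \<in> dihedral_perms n" "refl_perm n \<in> dihedral_perms n"
  "p \<in> dihedral_perms n \<Longrightarrow> q \<in> dihedral_perms n \<Longrightarrow> p \<circ> q \<in> dihedral_perms n"
  unfolding dihedral_perms_def
  using generate.one[of "sym_group n"] generate.eng[of p "sym_group n" _ q]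
  by (auto simp: sym_group_one sym_group_mult intro: generate.incl)

section \<open>Closure of the monoid and membership of the letters\<close>

lemma carrier_MDI:
  "carrier (MDI n) = {\<alpha>. (\<exists>p\<in>dihedral_perms n. \<exists>A\<subseteq>{1..n}. \<alpha> = (Some \<circ> p) |` A) \<and> monotone_pmap \<alpha>}"
  by (auto simp: MDI_def dihedral_inv_monoid_def)

lemma mult_MDI: "mult (MDI n) = (\<lambda>\<alpha> \<beta>. \<beta> \<circ>\<^sub>m \<alpha>)"
  by (simp add: MDI_def dihedral_inv_monoid_def sym_inv_monoid_def)

lemma monotone_pmap_comp:
  assumes "monotone_pmap \<alpha>" "monotone_pmap \<beta>" shows "monotone_pmap (\<beta> \<circ>\<^sub>m \<alpha>)"
proof -
  have D: "a \<in> dom (\<beta> \<circ>\<^sub>m \<alpha>) \<longleftrightarrow> a \<in> dom \<alpha> \<and> the (\<alpha> a) \<in> dom \<beta>" for a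
    by (auto simp: map_comp_def split: option.splits)
  have V: "a \<in> dom (\<beta> \<circ>\<^sub>m \<alpha>) \<Longrightarrow> the ((\<beta> \<circ>\<^sub>m \<alpha>) a) = the (\<beta> (the (\<alpha> a)))" for a
    by (auto simp: map_comp_def split: option.splits)
  from assms show ?thesis
    unfolding monotone_pmap_def
  proof (elim disjE)
    assume "order_preserving_pmap \<alpha>" "order_preserving_pmap \<beta>"
    then have "order_preserving_pmap (\<beta> \<circ>\<^sub>m \<alpha>)"
      unfolding order_preserving_pmap_def using D V by simp
    then show "order_preserving_pmap (\<beta> \<circ>\<^sub>m \<alpha>) \<or> order_reversing_pmap (\<beta> \<circ>\<^sub>m \<alpha>)" ..
  next
    assume "order_reversing_pmap \<alpha>" "order_preserving_pmap \<beta>"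
    then have "order_reversing_pmap (\<beta> \<circ>\<^sub>m \<alpha>)"
      unfolding order_preserving_pmap_def order_reversing_pmap_def using D V by simp
    then show "order_preserving_pmap (\<beta> \<circ>\<^sub>m \<alpha>) \<or> order_reversing_pmap (\<beta> \<circ>\<^sub>m \<alpha>)" ..
  next
    assume "order_preserving_pmap \<alpha>" "order_reversing_pmap \<beta>"
    then have "order_reversing_pmap (\<beta> \<circ>\<^sub>m \<alpha>)"
      unfolding order_preserving_pmap_def order_reversing_pmap_def using D V by simp
    then show "order_preserving_pmap (\<beta> \<circ>\<^sub>m \<alpha>) \<or> order_reversing_pmap (\<beta> \<circ>\<^sub>m \<alpha>)" ..
  next
    assume "order_reversing_pmap \<alpha>" "order_reversing_pmap \<beta>"
    then have "order_preserving_pmap (\<beta> \<circ>\<^sub>m \<alpha>)"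
      unfolding order_preserving_pmap_def order_reversing_pmap_def using D V by simp
    then show "order_preserving_pmap (\<beta> \<circ>\<^sub>m \<alpha>) \<or> order_reversing_pmap (\<beta> \<circ>\<^sub>m \<alpha>)" ..
  qed
qed

lemma MDI_comp_closed:
  assumes "\<alpha> \<in> carrier (MDI n)" "\<beta> \<in> carrier (MDI n)" shows "\<beta> \<circ>\<^sub>m \<alpha> \<in> carrier (MDI n)"
proof -
  from assms obtain p A q B where
    p: "p \<in> dihedral_perms n" "A \<subseteq> {1..n}" "\<alpha> = (Some \<circ> p) |` A" and
    q: "q \<in> dihedral_perms n" "\<beta> = (Some \<circ> q) |` B"
    unfolding carrier_MDI by blast
  have "\<beta> \<circ>\<^sub>m \<alpha> = (Some \<circ> (q \<circ> p)) |` (A \<inter> p -` B)"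
    unfolding p q by (auto simp: fun_eq_iff map_comp_def restrict_map_def)
  moreover have "A \<inter> p -` B \<subseteq> {1..n}" using p(2) by auto
  moreover have "monotone_pmap (\<beta> \<circ>\<^sub>m \<alpha>)"
    using assms monotone_pmap_comp unfolding carrier_MDI by blast
  ultimately show ?thesis
    using dihedral_perms_intros(4)[OF q(1) p(1)] unfolding carrier_MDI by blast
qed

lemma monotone_pmapI:
  "(\<forall>a b a' b'. \<alpha> a = Some a' \<and> \<alpha> b = Some b' \<and> a \<le> b \<longrightarrow> a' \<le> b') \<or>
   (\<forall>a b a' b'. \<alpha> a = Some a' \<and> \<alpha> b = Some b' \<and> a \<le> b \<longrightarrow> a' \<ge> b') \<Longrightarrow> monotone_pmap \<alpha>"
  unfolding monotone_pmap_def order_preserving_pmap_def order_reversing_pmap_def by fastforce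

context dims
begin

lemma step_in_MDI: assumes "l \<in> alphabet n m" shows "step n l \<in> carrier (MDI n)"
proof -
  note D = dihedral_perms_intros
  have intro: "step n l \<in> carrier (MDI n)"
    if "p \<in> dihedral_perms n" "A \<subseteq> {1..n}" "\<And>i. step n l i = (if i \<in> A then Some (p i) else None)"
      "monotone_pmap (step n l)" for p A
  proof -
    have "step n l = (Some \<circ> p) |` A" using that(3) by (auto simp: restrict_map_def)
    then show ?thesis unfolding carrier_MDI using that by blast
  qed
  \<comment> \<open>\<open>\<circ>\<close> applies its right argument first, so this is the
    reflection fixing 1, of which x_k and y_k are restrictions. Conjugating the rotation by
    \<open>refl_perm n\<close>, as in \<open>yy\<close>, gives its inverse, which restricts to
    \<open>y\<close>.\<close>
  have rr: "(rot_perm n \<circ> refl_perm n) i = (if i = 1 then 1 else n + 2 - i)" if "i \<in> {1..n}" for i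
    using that n by (auto simp: rot_perm_def refl_perm_def)
  have yy: "(refl_perm n \<circ> (rot_perm n \<circ> refl_perm n)) i = i - 1" if "i \<in> {2..n}" for i
    using that n by (auto simp: rot_perm_def refl_perm_def)
  have mono: "monotone_pmap (step n l)"
    using assms m_bounds
    by (cases l; intro monotone_pmapI) (auto simp: alphabet_def split: if_splits)
  consider "l = H" | "l = X" | "l = Y" | j where "l = E j"
    | k where "l = Xi k" "1 \<le> k" "k \<le> m" | k where "l = Yi k" "1 \<le> k" "k \<le> m"
    using assms by (auto simp: alphabet_def)
  then show ?thesis
  proof cases
    case 1
    then show ?thesis by (intro intro[OF D(3), of "{1..n}"] mono) (auto simp: refl_perm_def)
  next
    case 2
    then show ?thesis using n by (intro intro[OF D(2), of "{1..n-1}"] mono) (auto simp: rot_perm_def)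
  next
    case 3
    have "refl_perm n \<circ> (rot_perm n \<circ> refl_perm n) \<in> dihedral_perms n" using D by blast
    from this show ?thesis
      by (rule intro[of _ "{2..n}"]) (use mono n 3 in \<open>auto simp: yy simp del: o_apply\<close>)
  next
    case (4 j)
    then show ?thesis by (intro intro[OF D(1), of "{1..n} - {j}"] mono) auto
  next
    case (5 k)
    then show ?thesis using m_bounds
      by (intro intro[OF D(4)[OF D(2,3)], of "{1, k + 1}"] mono) (auto simp: rr simp del: o_apply)
  next
    case (6 k)
    then have k: "n + 1 - k \<in> {1..n}" "n + 1 - k \<noteq> 1" "n + 2 - (n + 1 - k) = k + 1"
      using m_bounds by auto
    have "(rot_perm n \<circ> refl_perm n) (n + 1 - k) = k + 1"
      unfolding rr[OF k(1)] using k(2,3) by simp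
    then show ?thesis using 6 m_bounds
      by (intro intro[OF D(4)[OF D(2,3)], of "{1, n + 1 - k}"] mono) (auto simp: rr simp del: o_apply)
  qed
qed

lemma act_in_MDI: "w \<in> lists (alphabet n m) \<Longrightarrow> act n w \<in> carrier (MDI n)"
proof (induction w)
  case Nil
  have "act n [] = (Some \<circ> id) |` {1..n}" by (simp add: act.simps)
  moreover have "monotone_pmap (act n [])"
    by (intro monotone_pmapI) (auto simp: act_Nil_apply split: if_splits)
  ultimately show ?case unfolding carrier_MDI using dihedral_perms_intros(1) by blast
next
  case (Cons l w)
  then show ?case using MDI_comp_closed[OF step_in_MDI[of l]] by (simp add: act.simps)
qed

section \<open>Words for the monotone elements\<close>

lemma translation_word:
  assumes dom: "\<And>i j. \<alpha> i = Some j \<Longrightarrow> i \<in> {1..n} \<and> j \<in> {1..n}"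
    and shift: "(\<forall>i j. \<alpha> i = Some j \<longrightarrow> j = i + k) \<or> (\<forall>i j. \<alpha> i = Some j \<longrightarrow> j + k = i)"
  shows "\<exists>w. op_word w \<and> act n w = \<alpha>"
proof -
  let ?L = "filter (\<lambda>i. \<alpha> i = None) [1..<Suc n]"
  have L: "set ?L \<subseteq> {1..n}" by auto
  have w: "op_word (restr_word n ?L @ pow X k)" "op_word (restr_word n ?L @ pow Y k)"
    using op_word_restr[OF L] by simp_all
  have outside: "act n w i = None" "\<alpha> i = None" if "i \<notin> {1..n}" "op_word w" for w i
    using act_outside[OF op_wordD[OF that(2)] m_bounds(1) that(1)] dom[of i] that(1)
    by (blast, cases "\<alpha> i", blast+)
  from shift show ?thesis
  proof
    assume shift: "\<forall>i j. \<alpha> i = Some j \<longrightarrow> j = i + k"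
    have "act n (restr_word n ?L @ pow X k) i = \<alpha> i" for i
    proof (cases "i \<in> {1..n}")
      case True
      show ?thesis
        using True act_restr_word[OF L True] dom[of i] shift[rule_format, of i]
        by (cases "\<alpha> i") (auto simp: act_words simp del: upt_Suc)
    qed (use outside w in simp)
    then show ?thesis using w(1) by blast
  next
    assume shift: "\<forall>i j. \<alpha> i = Some j \<longrightarrow> j + k = i"
    have "act n (restr_word n ?L @ pow Y k) i = \<alpha> i" for i
    proof (cases "i \<in> {1..n}")
      case True
      show ?thesis
        using True act_restr_word[OF L True] dom[of i] shift[rule_format, of i]
        by (cases "\<alpha> i") (auto simp: act_words simp del: upt_Suc)
    qed (use outside w in simp)
    then show ?thesis using w(2) by blast
  qed
qed

text \<open>
  If some pair of points at distance \<open>d\<close> is sent to a pair at distance \<open>n - d \<noteq> d\<close>, additivity of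
  distances leaves no room for a third point in the domain.
\<close>

lemma increasing_word:
  assumes dom: "\<And>i j. \<alpha> i = Some j \<Longrightarrow> i \<in> {1..n} \<and> j \<in> {1..n}"
    and incr: "\<And>i j i' j'. \<alpha> i = Some i' \<Longrightarrow> \<alpha> j = Some j' \<Longrightarrow> i < j \<Longrightarrow> i' < j'"
    and dist: "\<And>i j i' j'. \<alpha> i = Some i' \<Longrightarrow> \<alpha> j = Some j' \<Longrightarrow> i < j \<Longrightarrow>
      j' + i = i' + j \<or> j' + j = n + i + i'"
  shows "\<exists>w. op_word w \<and> act n w = \<alpha>"
proof (cases "\<exists>i j i' j'. \<alpha> i = Some i' \<and> \<alpha> j = Some j' \<and> i < j \<and> j' + i \<noteq> i' + j")
  case True
  then obtain i j i' j' where ij: "\<alpha> i = Some i'" "\<alpha> j = Some j'" "i < j" "j' + i \<noteq> i' + j" by blast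
  \<comment> \<open>The subtraction-free form of \<open>j' - i' = n - (j - i)\<close>.\<close>
  then have ij': "j' + j = n + i + i'" using dist by blast
  have b: "1 \<le> i" "i \<le> n" "1 \<le> j" "j \<le> n" "1 \<le> i'" "i' \<le> n" "1 \<le> j'" "j' \<le> n"
    using dom[OF ij(1)] dom[OF ij(2)] by auto
  have only: "\<alpha> l = None" if ne: "l \<noteq> i" "l \<noteq> j" for l
  proof (rule ccontr)
    assume "\<alpha> l \<noteq> None"
    then obtain l' where l: "\<alpha> l = Some l'" by blast
    have bl: "1 \<le> l" "l \<le> n" "1 \<le> l'" "l' \<le> n" using dom[OF l] by auto
    consider "l < i" | "i < l" "l < j" | "j < l" using ne by linarith
    then show False
    proof cases
      case 1
      then show False
        using dist[OF l ij(1)] dist[OF l ij(2)] incr[OF l ij(1)] incr[OF ij(1,2)] ij b bl ij' by linarith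
    next
      case 2
      then show False
        using dist[OF ij(1) l] dist[OF l ij(2)] incr[OF ij(1) l] incr[OF l ij(2)] ij b bl ij' by linarith
    next
      case 3
      then show False
        using dist[OF ij(1) l] dist[OF ij(2) l] incr[OF ij(1) l] incr[OF ij(2) l] ij b bl ij' by linarith
    qed
  qed
  obtain z where z: "flip_letter n m z (j - i + 1) (n + 1 - (j - i))"
  proof (cases "j - i \<le> m")
    case True
    then have "flip_letter n m (Xi (j - i)) (j - i + 1) (n + 1 - (j - i))"
      using ij(3) by (auto simp: flip_letter_def)
    then show ?thesis using that by blast
  next
    case False
    \<comment> \<open>Otherwise both alternatives for the distance coincide and the pair is merely
      translated. Hence one of \<open>j - i\<close> and \<open>n - (j - i)\<close> is at most
      \<open>m\<close> and indexes a letter.\<close>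
    have "n \<noteq> 2 * (j - i)" using ij b ij' by linarith
    then have "1 \<le> n - (j - i)" "n - (j - i) \<le> m" using False m b ij(3) by linarith+
    moreover have "j - i + 1 = n + 1 - (n - (j - i))" "n + 1 - (j - i) = n - (j - i) + 1"
      using b by linarith+
    ultimately have "flip_letter n m (Yi (n - (j - i))) (j - i + 1) (n + 1 - (j - i))"
      unfolding flip_letter_def by (metis atLeastAtMost_iff)
    then show ?thesis using that by blast
  qed
  \<comment> \<open>The first power brings the pair to 1 and \<open>j - i + 1\<close>, the letter
    replaces the distance by its complement, and the last power moves 1 to \<open>i'\<close> and
    hence the other point to \<open>j'\<close>.\<close>
  let ?w = "pow Y (i - 1) @ [z] @ pow X (i' - 1)"
  have "act n ?w l = \<alpha> l" for l
  proof -
    have "act n ?w l = (if l = i - 1 + 1 then Some (i' - 1 + 1) else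
        if l = i - 1 + (j - i + 1) then Some (i' - 1 + (n + 1 - (j - i))) else None)"
      using b ij(3) ij' by (intro act_flip_word[OF z]) linarith+
    moreover have "i - 1 + 1 = i" "i' - 1 + 1 = i'" "i - 1 + (j - i + 1) = j"
      "i' - 1 + (n + 1 - (j - i)) = j'" using b ij(3) ij' by linarith+
    ultimately show ?thesis using only[of l] ij(1,2) by auto
  qed
  moreover have "op_word ?w" using flip_in_alphabet[OF z] by simp
  ultimately show ?thesis by blast
next
  case False
  then have trans: "j' + i = i' + j" if "\<alpha> i = Some i'" "\<alpha> j = Some j'" for i j i' j'
    using that by (metis linorder_neqE_nat add.commute option.inject)
  show ?thesis
  proof (cases "\<exists>i j. \<alpha> i = Some j")
    case True
    then obtain i j where ij: "\<alpha> i = Some j" by blast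
    show ?thesis
    proof (cases "i \<le> j")
      case True
      have "l' = l + (j - i)" if "\<alpha> l = Some l'" for l l'
        using trans[OF ij that] True by linarith
      then show ?thesis using translation_word[of \<alpha> "j - i"] dom by blast
    next
      case False
      have "l' + (i - j) = l" if "\<alpha> l = Some l'" for l l'
        using trans[OF ij that] False by linarith
      then show ?thesis using translation_word[of \<alpha> "i - j"] dom by blast
    qed
  next
    case False
    then show ?thesis using translation_word[of \<alpha> 0] dom by blast
  qed
qed

lemma MDI_preserving_word:
  assumes "\<alpha> \<in> carrier (MDI n)" "order_preserving_pmap \<alpha>"
  shows "\<exists>w. op_word w \<and> act n w = \<alpha>"
proof -
  obtain p A where p: "p \<in> dihedral_perms n" "A \<subseteq> {1..n}" "\<alpha> = (Some \<circ> p) |` A"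
    using assms(1) unfolding carrier_MDI by blast
  have perm: "p permutes {1..n}" "dist_compat n p" using dihedral_permutes_dist[of n p] p n by auto
  have \<alpha>: "\<alpha> i = Some j \<longleftrightarrow> i \<in> A \<and> j = p i" for i j by (auto simp: p(3) restrict_map_def)
  show ?thesis
  proof (rule increasing_word)
    show "i \<in> {1..n} \<and> j \<in> {1..n}" if "\<alpha> i = Some j" for i j
      using that p(2) permutes_in_image[OF perm(1), of i] by (auto simp: \<alpha>)
    show incr: "i' < j'" if "\<alpha> i = Some i'" "\<alpha> j = Some j'" "i < j" for i j i' j'
    proof -
      have "i' \<le> j'" using assms(2) that unfolding order_preserving_pmap_def
        by (metis domI less_imp_le option.sel)
      moreover have "i' \<noteq> j'" using that permutes_inj[OF perm(1)] by (auto simp: \<alpha> dest: injD)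
      ultimately show ?thesis by simp
    qed
    show "j' + i = i' + j \<or> j' + j = n + i + i'" if "\<alpha> i = Some i'" "\<alpha> j = Some j'" "i < j" for i j i' j'
    proof -
      have "\<bar>int j' - int i'\<bar> \<in> {\<bar>int j - int i\<bar>, int n - \<bar>int j - int i\<bar>}"
        using that p(2) perm(2) unfolding \<alpha> dist_compat_def by blast
      then show ?thesis using incr[OF that] that(3) by auto
    qed
  qed
qed

lemma MDI_word:
  assumes "\<alpha> \<in> carrier (MDI n)" shows "\<exists>w. w \<in> lists (alphabet n m) \<and> act n w = \<alpha>"
proof -
  have H: "H \<in> alphabet n m" by (simp add: alphabet_def)
  have "monotone_pmap \<alpha>" using assms unfolding carrier_MDI by simp
  then consider "order_preserving_pmap \<alpha>" | "order_reversing_pmap \<alpha>"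
    unfolding monotone_pmap_def by blast
  then show ?thesis
  proof cases
    case 1
    then show ?thesis using MDI_preserving_word[OF assms] op_wordD by blast
  next
    case 2
    \<comment> \<open>\<open>\<alpha>\<close> followed by \<open>h\<close> is order-preserving;
      appending \<open>h\<close> to a word for it restores \<open>\<alpha>\<close>.\<close>
    let ?\<beta> = "step n H \<circ>\<^sub>m \<alpha>"
    have ran: "j \<in> {1..n}" if "\<alpha> i = Some j" for i j
    proof -
      obtain p A where p: "p \<in> dihedral_perms n" "A \<subseteq> {1..n}" "\<alpha> = (Some \<circ> p) |` A"
        using assms unfolding carrier_MDI by blast
      have "p permutes {1..n}" using dihedral_permutes_dist[of n p] p n by auto
      from permutes_in_image[OF this, of i] show ?thesis
        using that p by (auto simp: restrict_map_def split: if_splits)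
    qed
    have \<beta>: "?\<beta> i = map_option (\<lambda>j. n + 1 - j) (\<alpha> i)" for i
      using ran[of i] by (cases "\<alpha> i") (auto simp: map_comp_def)
    have "order_preserving_pmap ?\<beta>"
      using 2 unfolding order_preserving_pmap_def order_reversing_pmap_def
      by (auto simp: \<beta> dom_def intro!: diff_le_mono2) fastforce
    then obtain w where w: "op_word w" "act n w = ?\<beta>"
      using MDI_preserving_word MDI_comp_closed[OF assms step_in_MDI[OF H]] by blast
    have "act n (w @ [H]) i = \<alpha> i" for i
      unfolding act_append_H[OF op_wordD[OF w(1)]] w(2) \<beta>
      using ran[of i] by (cases "\<alpha> i") auto
    then show ?thesis using op_wordD[OF w(1)] H by (intro exI[of _ "w @ [H]"]) auto
  qed
qed

end

section \<open>The isomorphism\<close>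

text \<open>A wrapper around functions that carries composition as multiplication, so that it can be
  an instance of \<open>monoid_mult\<close>.\<close>

datatype 'a endo = Endo (endo_app: "'a \<Rightarrow> 'a")

instantiation endo :: (type) monoid_mult
begin

definition one_endo :: "'a endo" where "1 = Endo id"

definition times_endo :: "'a endo \<Rightarrow> 'a endo \<Rightarrow> 'a endo" where
  "a * b = Endo (endo_app a \<circ> endo_app b)"

instance
  by standard (simp_all add: one_endo_def times_endo_def comp_assoc)

end

text \<open>
  The quotient monoid acts faithfully on its elements by left multiplication. Sets that are not
  classes are fixed, so that words congruent to the empty word act as the identity everywhere.
\<close>

definition class_endo :: "letter set \<Rightarrow> (letter list \<times> letter list) set \<Rightarrow> letter \<Rightarrow> letter list set endo" where
  "class_endo B r a = Endo (\<lambda>S. if S \<in> lists B // r then r `` ((#) a ` S) else S)"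

lemma free_monoid_simps [simp]:
  "carrier (free_monoid B) = lists B" "mult (free_monoid B) = (@)" "one (free_monoid B) = []"
  by (simp_all add: free_monoid_def)

lemma monoid_congruence_append:
  assumes "monoid_congruence (free_monoid B) r" "(a, b) \<in> r" "(c, d) \<in> r"
  shows "(a @ c, b @ d) \<in> r"
  using assms unfolding monoid_congruence_def by force

lemma class_endo_word:
  assumes r: "monoid_congruence (free_monoid B) r" and w: "w \<in> lists B" and v: "v \<in> lists B"
  shows "endo_app (word_prod (class_endo B r) w) (r `` {v}) = r `` {w @ v}"
  using w
proof (induction w)
  case Nil
  show ?case by (simp add: one_endo_def)
next
  case (Cons a w)
  have eq: "equiv (lists B) r" using r by (simp add: monoid_congruence_def)
  have wv: "w @ v \<in> lists B" "[a] \<in> lists B" using Cons v by auto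
  then have "r `` {w @ v} \<in> lists B // r" by (intro quotientI)
  moreover have "r `` ((#) a ` (r `` {w @ v})) = r `` {a # w @ v}"
  proof -
    have refl: "(s, s) \<in> r" if "s \<in> lists B" for s
      using eq that by (auto simp: equiv_def refl_on_def)
    have cong: "(a # w @ v, a # u) \<in> r" if "(w @ v, u) \<in> r" for u
      using monoid_congruence_append[OF r refl[OF wv(2)] that] by simp
    have "trans r" using eq by (simp add: equiv_def)
    then show ?thesis using cong refl[OF wv(1)] by (fastforce dest: transD)
  qed
  ultimately show ?case using Cons by (simp add: times_endo_def class_endo_def)
qed

lemma class_endo_outside:
  "S \<notin> lists B // r \<Longrightarrow> endo_app (word_prod (class_endo B r) w) S = S"
  by (induction w) (simp_all add: one_endo_def times_endo_def class_endo_def)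

text \<open>Faithfulness comes from evaluating at the class of the empty word.\<close>

lemma class_endo_eq_iff:
  assumes r: "monoid_congruence (free_monoid B) r" and u: "u \<in> lists B" and v: "v \<in> lists B"
  shows "word_prod (class_endo B r) u = word_prod (class_endo B r) v \<longleftrightarrow> (u, v) \<in> r"
proof
  have eq: "equiv (lists B) r" using r by (simp add: monoid_congruence_def)
  assume "word_prod (class_endo B r) u = word_prod (class_endo B r) v"
  then have "r `` {u} = r `` {v}"
    using class_endo_word[OF r u, of "[]"] class_endo_word[OF r v, of "[]"] by simp
  then show "(u, v) \<in> r" using eq_equiv_class[OF _ eq v] by blast
next
  have eq: "equiv (lists B) r" using r by (simp add: monoid_congruence_def)
  assume uv: "(u, v) \<in> r"
  have "endo_app (word_prod (class_endo B r) u) S = endo_app (word_prod (class_endo B r) v) S" for S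
  proof (cases "S \<in> lists B // r")
    case True
    then obtain s where s: "s \<in> lists B" "S = r `` {s}" by (auto simp: quotient_def)
    then have "(s, s) \<in> r" using eq by (auto simp: equiv_def refl_on_def)
    then have "(u @ s, v @ s) \<in> r" by (rule monoid_congruence_append[OF r uv])
    then show ?thesis
      using s class_endo_word[OF r u s(1)] class_endo_word[OF r v s(1)] equiv_class_eq[OF eq] by simp
  qed (simp add: class_endo_outside)
  then show "word_prod (class_endo B r) u = word_prod (class_endo B r) v"
    by (intro endo.expand ext)
qed

text \<open>The given congruence \<open>r\<close> makes the intersected family nonempty, which
  confines the intersection to the carrier. The kernel of the action will serve as
  \<open>r\<close>.\<close>

lemma monoid_congruence_generated:
  assumes "monoid_congruence M r" "V \<subseteq> r"
  shows "monoid_congruence M (generated_congruence M V)" "V \<subseteq> generated_congruence M V"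
    "generated_congruence M V \<subseteq> r"
proof -
  show "V \<subseteq> generated_congruence M V" "generated_congruence M V \<subseteq> r"
    using assms by (auto simp: generated_congruence_def)
  let ?C = "{r. monoid_congruence M r \<and> V \<subseteq> r}"
  have ne: "r \<in> ?C" using assms by simp
  have C: "s \<subseteq> carrier M \<times> carrier M" "refl_on (carrier M) s" "sym s" "trans s" if "s \<in> ?C" for s
    using that by (simp_all add: monoid_congruence_def equiv_def)
  have "equiv (carrier M) (\<Inter>?C)"
  proof (rule equivI)
    show "\<Inter>?C \<subseteq> carrier M \<times> carrier M" using C(1)[OF ne] ne by blast
    show "refl_on (carrier M) (\<Inter>?C)" using C(2) unfolding refl_on_def by blast
    show "sym (\<Inter>?C)" using C(3) unfolding sym_def by blast
    show "trans (\<Inter>?C)" using C(4) unfolding trans_def by blast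
  qed
  moreover have "(a \<otimes>\<^bsub>M\<^esub> c, b \<otimes>\<^bsub>M\<^esub> d) \<in> \<Inter>?C" if "(a, b) \<in> \<Inter>?C" "(c, d) \<in> \<Inter>?C" for a b c d
  proof
    fix s assume s: "s \<in> ?C"
    then have "(a, b) \<in> s" "(c, d) \<in> s" using that by auto
    then show "(a \<otimes>\<^bsub>M\<^esub> c, b \<otimes>\<^bsub>M\<^esub> d) \<in> s"
      using s unfolding monoid_congruence_def by blast
  qed
  ultimately show "monoid_congruence M (generated_congruence M V)"
    unfolding monoid_congruence_def generated_congruence_def by blast
qed

section \<open>The generated congruence as the kernel of the action\<close>

context dims
begin

definition act_kernel :: "(letter list \<times> letter list) set" where
  "act_kernel = {(u, v). u \<in> lists (alphabet n m) \<and> v \<in> lists (alphabet n m) \<and> act n u = act n v}"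

lemma act_kernel_congruence: "monoid_congruence (free_monoid (alphabet n m)) act_kernel"
  unfolding monoid_congruence_def free_monoid_simps
proof (intro conjI equivI)
  show "\<forall>(a, b)\<in>act_kernel. \<forall>(c, d)\<in>act_kernel. (a @ c, b @ d) \<in> act_kernel"
    unfolding act_kernel_def using act_append[OF _ _ m_bounds(1)] by simp
qed (auto simp: act_kernel_def refl_on_def sym_def trans_def)

lemma generated_eq_act_kernel:
  "generated_congruence (free_monoid (alphabet n m)) (relations n m) = act_kernel"
proof -
  let ?R = "generated_congruence (free_monoid (alphabet n m)) (relations n m)"
  have "relations n m \<subseteq> act_kernel"
    using relations_in_lists[OF n m] relations_sound[OF n m] by (auto simp: act_kernel_def)
  note R = monoid_congruence_generated[OF act_kernel_congruence this]
  have in_lists: "u \<in> lists (alphabet n m) \<and> v \<in> lists (alphabet n m)" if "(u, v) \<in> ?R" for u v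
    using R(3) that by (auto simp: act_kernel_def)
  \<comment> \<open>The assumption \<open>sound\<close> holds here because the generated congruence
    lies in the kernel.\<close>
  interpret presented n m "class_endo (alphabet n m) ?R"
  proof
    show "word_prod (class_endo (alphabet n m) ?R) u = word_prod (class_endo (alphabet n m) ?R) v"
      if "(u, v) \<in> relations n m" for u v
      using class_endo_eq_iff[OF R(1)] R(2) that in_lists by blast
    show "act n u = act n v" if "u \<in> lists (alphabet n m)" "v \<in> lists (alphabet n m)"
      "word_prod (class_endo (alphabet n m) ?R) u = word_prod (class_endo (alphabet n m) ?R) v" for u v
      using class_endo_eq_iff[OF R(1) that(1,2)] that(3) R(3) by (auto simp: act_kernel_def)
  qed
  have "act_kernel \<subseteq> ?R"
    using complete class_endo_eq_iff[OF R(1)] by (auto simp: act_kernel_def)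
  then show ?thesis using R(3) by blast
qed

text \<open>Fibres of the action are the kernel classes, so this is the inverse of the map that
  \<open>act\<close> induces on the quotient; taking fibres avoids a choice of
  representatives.\<close>

definition word_class :: "(nat \<rightharpoonup> nat) \<Rightarrow> letter list set" where
  "word_class \<alpha> = {w \<in> lists (alphabet n m). act n w = \<alpha>}"

lemma word_class_act: "u \<in> lists (alphabet n m) \<Longrightarrow> word_class (act n u) = act_kernel `` {u}"
  by (auto simp: word_class_def act_kernel_def)

lemma word_class_iso:
  "word_class \<in> iso (MDI n) (quotient_monoid (free_monoid (alphabet n m)) act_kernel)"
    (is "_ \<in> iso _ ?Q")
proof (rule isoI)
  let ?L = "lists (alphabet n m)"
  have surj: "\<exists>w\<in>?L. act n w = \<alpha>" if "\<alpha> \<in> carrier (MDI n)" for \<alpha>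
    using MDI_word[OF that] by blast
  have carrier_Q: "carrier ?Q = ?L // act_kernel"
    and mult_Q: "P \<otimes>\<^bsub>?Q\<^esub> P' = (\<Union>p\<in>P. \<Union>q\<in>P'. act_kernel `` {p @ q})" for P P'
    by (simp_all add: quotient_monoid_def)
  have image: "word_class ` carrier (MDI n) = carrier ?Q"
  proof (intro equalityI subsetI)
    fix S assume "S \<in> word_class ` carrier (MDI n)"
    then obtain w where "w \<in> ?L" "S = word_class (act n w)" using surj by blast
    then show "S \<in> carrier ?Q" by (simp add: carrier_Q word_class_act quotientI)
  next
    fix S assume "S \<in> carrier ?Q"
    then obtain w where "w \<in> ?L" "S = act_kernel `` {w}"
      unfolding carrier_Q by (auto simp: quotient_def)
    then show "S \<in> word_class ` carrier (MDI n)" using act_in_MDI word_class_act by blast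
  qed
  show "word_class \<in> hom (MDI n) ?Q"
  proof (rule homI)
    show "word_class \<alpha> \<in> carrier ?Q" if "\<alpha> \<in> carrier (MDI n)" for \<alpha>
      using that image by blast
    fix \<alpha> \<beta> assume \<alpha>: "\<alpha> \<in> carrier (MDI n)" and \<beta>: "\<beta> \<in> carrier (MDI n)"
    obtain u v where u: "u \<in> ?L" "act n u = \<alpha>" and v: "v \<in> ?L" "act n v = \<beta>"
      using surj[OF \<alpha>] surj[OF \<beta>] by blast
    have app: "act n (p @ q) = \<beta> \<circ>\<^sub>m \<alpha>" if "p \<in> word_class \<alpha>" "q \<in> word_class \<beta>" for p q
      using that act_append[OF _ _ m_bounds(1)] by (simp add: word_class_def)
    have "act_kernel `` {p @ q} = word_class (\<beta> \<circ>\<^sub>m \<alpha>)" if "p \<in> word_class \<alpha>" "q \<in> word_class \<beta>" for p q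
      using that app[OF that] word_class_act[of "p @ q"] by (simp add: word_class_def)
    \<comment> \<open>The product of classes is a union over representatives; as both classes are
      nonempty, it is the common class and not the empty set.\<close>
    moreover have "u \<in> word_class \<alpha>" "v \<in> word_class \<beta>" using u v by (simp_all add: word_class_def)
    ultimately show "word_class (\<alpha> \<otimes>\<^bsub>MDI n\<^esub> \<beta>) = word_class \<alpha> \<otimes>\<^bsub>?Q\<^esub> word_class \<beta>"
      unfolding mult_Q mult_MDI by blast
  qed
  have "inj_on word_class (carrier (MDI n))"
  proof (rule inj_onI)
    fix \<alpha> \<beta> assume \<alpha>: "\<alpha> \<in> carrier (MDI n)" and "word_class \<alpha> = word_class \<beta>"
    then show "\<alpha> = \<beta>" using surj[OF \<alpha>] by (auto simp: word_class_def)
  qed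
  then show "bij_betw word_class (carrier (MDI n)) (carrier ?Q)"
    using image by (simp add: bij_betw_def)
qed

end

theorem theorem4p1:
  fixes n m :: nat
  assumes "n \<ge> 4" and "m = (n - 1) div 2"
  shows "real (card (alphabet n m)) = 2 * real n - (1 + (-1) ^ n) / 2 \<and>
    real (card (relations n m)) =
      1 / 2 * (5 * real n ^ 2 + (2 - 2 * (-1) ^ n) * real n - (3 + 5 * (-1) ^ n) / 2) \<and>
    defined_by_presentation (MDI n) (alphabet n m) (relations n m)"
proof -
  interpret dims n m using assms by unfold_locales
  have "defined_by_presentation (MDI n) (alphabet n m) (relations n m)"
    using relations_in_lists[OF assms] word_class_iso
    unfolding defined_by_presentation_def generated_eq_act_kernel is_iso_def by blast
  then show ?thesis using card_alphabet[OF assms] card_relations[OF assms] by blast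
qed

end
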